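(* Let $p$ be an odd prime, $n$ an even positive integer, $v=v_p(n)$, and write $x^n-1=(x-1)^{p^{v}}(x+1)^{p^{v}}r_{1}^{p^{v}}\cdots r_{k}^{p^{v}}$ in $\mathbb{F}_p[x]$ with $r_1,\dots,r_k$ distinct monic prime self-reciprocal polynomials of even degree. Then \[ \mathcal{G}^{(p)}_{n}(z)=\sum_{t=0}^n\mathcal{N}^{(p)}_n(n-t)z^t=\left(1+\sum_{j=1}^{\frac{p^{v}+1}{2}}p^{j-1}(p-1)z^{2j-1}\right)^2\prod_{i=1}^{k}G_i(z), \] where \[ G_i(z)=1+\sum_{j=1}^{p^{v}}\left(p^{\frac{\deg(r_i^{j})}{2}}-p^{\frac{\deg(r_i^{j})-\deg(r_i)}{2}}\right)z^{j\deg(r_i)}. \]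
   Context: $\mathrm{Tr}_n:\mathbb{F}_{p^n}\to\mathbb{F}_p$ is the absolute trace, $\epsilon_p=e^{2\pi i/p}$. The Walsh transform of $f:\mathbb{F}_{p^n}\to\mathbb{F}_p$ is $\widehat f(b)=\sum_{x}\epsilon_p^{f(x)-\mathrm{Tr}_n(bx)}$; for an integer $0\le s\le n$, $f$ is $s$-plateaued if $|\widehat f(b)|\in\{0,p^{(n+s)/2}\}$ for all $b$. $\mathcal{D}$ is the set of functions $Q(x)=\mathrm{Tr}_n\big(\sum_{i=0}^{n/2}a_ix^{p^i+1}\big)$, $a_i\in\mathbb{F}_p$, including the zero function ($n$-plateaued); $\mathcal{N}^{(p)}_n(s)$ is the number of tuples $(a_0,\dots,a_{n/2})\in\mathbb{F}_p^{n/2+1}$ for which $Q$ is $s$-plateaued. For $f\in\mathbb{F}_p[x]$ with $f(0)\ne0$, $f^*(x)=x^{\deg f}f(1/x)$; $f$ is self-reciprocal if $f^*=f$. A monic $f$ is prime self-reciprocal if either $f$ is irreducible and self-reciprocal, or $f=ugg^*$ with $g$ monic irreducible, $g^*$ not a constant multiple of $g$, $u\in\mathbb{F}_p^*$. *)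

theory Defs
  imports
    Complex_Main
    "HOL-Library.FuncSet"
    "Berlekamp_Zassenhaus.Finite_Field"
begin

text \<open>
  The prime field with \<open>p\<close> elements is the type \<open>'p mod_ring\<close> with \<open>p = CARD('p)\<close>; the field with
  \<open>p ^ n\<close> elements is any finite field type \<open>'a\<close> of that cardinality. The next function is the
  (unique) inclusion of the prime field, a ring homomorphism whenever \<open>'a\<close> has characteristic \<open>p\<close>.
\<close>

definition Fp_incl :: "'p::prime_card mod_ring \<Rightarrow> 'a::field" where
  "Fp_incl c = of_int (to_int_mod_ring c)"

text \<open>
  The sum of the conjugates of \<open>x\<close> lies in the prime subfield; \<open>abs_trace n x\<close> is that element,
  viewed in \<open>'p mod_ring\<close>. It is meaningful for \<open>CARD('a) = p ^ n\<close>.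
\<close>

definition abs_trace :: "nat \<Rightarrow> 'a::field \<Rightarrow> 'p::prime_card mod_ring" where
  "abs_trace n x = (THE c. (Fp_incl c :: 'a) = (\<Sum>i<n. x ^ (CARD('p) ^ i)))"

definition eps_pow :: "'p::prime_card mod_ring \<Rightarrow> complex" where
  "eps_pow c = exp (2 * of_real pi * \<i> / of_nat CARD('p)) powi to_int_mod_ring c"

definition walsh :: "nat \<Rightarrow> ('a::{field,finite} \<Rightarrow> 'p::prime_card mod_ring) \<Rightarrow> 'a \<Rightarrow> complex" where
  "walsh n f b = (\<Sum>x\<in>UNIV. eps_pow (f x - abs_trace n (b * x)))"

definition plateaued :: "nat \<Rightarrow> nat \<Rightarrow> ('a::{field,finite} \<Rightarrow> 'p::prime_card mod_ring) \<Rightarrow> bool" where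
  "plateaued n s f \<longleftrightarrow>
     s \<le> n \<and> (\<forall>b. cmod (walsh n f b) \<in> {0, real CARD('p) powr ((real n + real s) / 2)})"

definition quad_fun :: "nat \<Rightarrow> (nat \<Rightarrow> 'p::prime_card mod_ring) \<Rightarrow> 'a::{field,finite} \<Rightarrow> 'p mod_ring" where
  "quad_fun n a x = abs_trace n (\<Sum>i=0..n div 2. Fp_incl (a i) * x ^ (CARD('p) ^ i + 1))"

text \<open>
  Coefficient tuples \<open>(a\<^sub>0, \<dots>, a\<^sub>n\<^sub>/\<^sub>2)\<close> are extensional functions on \<open>{0..n div 2}\<close>. The type
  arguments select the fields with \<open>p ^ n\<close> and \<open>p\<close> elements.
\<close>

definition plateaued_count ::
    "'a::{field,finite} itself \<Rightarrow> 'p::prime_card itself \<Rightarrow> nat \<Rightarrow> nat \<Rightarrow> nat" where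
  "plateaued_count _ _ n s =
     card {a \<in> {0..n div 2} \<rightarrow>\<^sub>E (UNIV :: 'p mod_ring set).
             plateaued n s (quad_fun n a :: 'a \<Rightarrow> 'p mod_ring)}"

text \<open>
  For \<open>coeff f 0 \<noteq> 0\<close>, \<open>reflect_poly f\<close> is \<open>f\<^sup>*(x) = x ^ degree f * f (1/x)\<close>. For other \<open>f\<close> the
  reciprocal is not defined, hence the explicit side conditions below.
\<close>

definition self_reciprocal :: "'k::field poly \<Rightarrow> bool" where
  "self_reciprocal f \<longleftrightarrow> coeff f 0 \<noteq> 0 \<and> reflect_poly f = f"

definition prime_self_reciprocal :: "'k::field poly \<Rightarrow> bool" where
  "prime_self_reciprocal f \<longleftrightarrow>
     monic f \<and>
     ((irreducible f \<and> self_reciprocal f) \<or>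
      (\<exists>u g. u \<noteq> 0 \<and> monic g \<and> irreducible g \<and> coeff g 0 \<noteq> 0 \<and>
             (\<forall>c. reflect_poly g \<noteq> smult c g) \<and>
             f = smult u (g * reflect_poly g)))"

end

theory Submission
  imports Defs
begin

text \<open>
  Put \<open>A\<^sub>a = (\<Sum>i\<le>n/2. a\<^sub>i (x ^ i + x ^ (n - i)))\<close>. Polarizing the quadratic form \<open>Q\<close> gives
  \<open>Q (x + y) - Q x - Q y = Tr (y L x)\<close>, where \<open>L\<close> is \<open>A\<^sub>a\<close> evaluated at the Frobenius map; hence the
  squared absolute value of the Walsh transform is \<open>p ^ n\<close> times a character sum over the kernel of
  \<open>L\<close>, and \<open>Q\<close> is \<open>s\<close>-plateaued iff that kernel has \<open>p ^ s\<close> elements, i.e. iff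
  \<open>s = deg (gcd A\<^sub>a (x ^ n - 1))\<close>.

  Modulo \<open>x ^ n - 1\<close> the polynomials \<open>A\<^sub>a\<close> run bijectively through the residues fixed by the
  involution \<open>x \<mapsto> 1/x\<close>. By the Chinese remainder theorem the generating function of the degrees
  \<open>deg H - deg (gcd A H)\<close> over the fixed residues \<open>A\<close> modulo \<open>H\<close> is multiplicative in \<open>H\<close>. For
  \<open>H = r ^ m\<close> the fixed residues divisible by \<open>r ^ j\<close> number \<open>p\<close> to the power \<open>deg (r ^ (m - j)) / 2\<close>,
  rounded up: after a shift they are palindromic coefficient sequences.
\<close>

section \<open>Residues fixed by inversion\<close>

text \<open>Counting by divisibility gives the generating function only if
  \<open>gcd A (r ^ m)\<close> is always a power of \<open>r\<close>, up to a constant. When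
  \<open>r = u g g'\<close> with \<open>g'\<close> the reciprocal of \<open>g\<close>, this comes
  from symmetry: inversion exchanges \<open>g\<close> and \<open>g'\<close>, so a fixed residue
  cannot favour one of them. The linear factors behave differently. Since
  \<open>1/x - c = - (c/x) (x - c)\<close> for \<open>c = 1\<close> or \<open>c = - 1\<close>,
  inversion acts on the leading term of order \<open>j\<close> at \<open>c\<close> by the sign
  \<open>(- 1) ^ j\<close>; a nonzero fixed residue modulo \<open>(x - c) ^ m\<close> therefore
  vanishes to even order at \<open>c\<close>. As \<open>m = p ^ v\<close> is odd, only odd exponents
  of \<open>z\<close> survive beside the constant term, and the coefficients
  \<open>p ^ (j - 1) (p - 1)\<close> are differences \<open>p ^ j - p ^ (j - 1)\<close> of
  consecutive counts.\<close>

text \<open>A formal degree \<open>m\<close> makes reversal linear and, on degrees up to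
  \<open>m\<close>, an involution; \<open>reflect_poly\<close>, which uses the true degree, has
  neither property in general.\<close>

definition rev_window :: "nat \<Rightarrow> 'k::comm_ring_1 poly \<Rightarrow> 'k poly" where
  "rev_window m A = (\<Sum>i\<le>m. monom (coeff A i) (m - i))"

lemma coeff_rev_window: "coeff (rev_window m A) j = (if j \<le> m then coeff A (m - j) else 0)"
proof (cases "j \<le> m")
  case True
  have "coeff (rev_window m A) j = (\<Sum>i\<le>m. if i = m - j then coeff A i else 0)"
    unfolding rev_window_def coeff_sum using True by (intro sum.cong) auto
  then show ?thesis using True by simp
next
  case False
  then show ?thesis unfolding rev_window_def coeff_sum by (auto intro!: sum.neutral)
qed

lemma rev_window_diff: "rev_window m (A - B) = rev_window m A - rev_window m B"
  by (rule poly_eqI) (simp add: coeff_rev_window)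

lemma rev_window_smult: "rev_window m (smult c A) = smult c (rev_window m A)"
  by (rule poly_eqI) (simp add: coeff_rev_window)

lemma rev_window_rev_window: "degree A \<le> m \<Longrightarrow> rev_window m (rev_window m A) = A"
  by (rule poly_eqI) (auto simp: coeff_rev_window coeff_eq_0)

lemma degree_rev_window: "degree (rev_window m A) \<le> m"
  by (rule degree_le) (simp add: coeff_rev_window)

lemma rev_window_degree: "rev_window (degree A) A = reflect_poly A"
  by (rule poly_eqI) (simp add: coeff_rev_window coeff_reflect_poly)

lemma poly_as_sum_of_monoms_ge: "degree A \<le> m \<Longrightarrow> A = (\<Sum>i\<le>m. monom (coeff A i) i)"
  by (rule poly_eqI) (auto simp: coeff_sum coeff_eq_0)

text \<open>Substitution of \<open>x ^ (n - 1)\<close> represents \<open>x \<mapsto> 1/x\<close> modulo \<open>x ^ n - 1\<close>.\<close>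

definition recip :: "nat \<Rightarrow> 'k::comm_ring_1 poly \<Rightarrow> 'k poly" where
  "recip n A = pcompose A (monom 1 (n - 1))"

lemma recip_diff: "recip n (A - B) = recip n A - recip n B"
  by (simp add: recip_def pcompose_diff)

lemma recip_mult: "recip n (A * B) = recip n A * recip n B"
  by (simp add: recip_def pcompose_mult)

lemma recip_1 [simp]: "recip n 1 = 1"
  by (simp add: recip_def pcompose_1)

lemma recip_0 [simp]: "recip n 0 = 0"
  by (simp add: recip_def)

lemma recip_power: "recip n (A ^ j) = recip n A ^ j"
  by (induction j) (simp_all add: recip_mult)

lemma recip_monom: "recip n (monom c k) = monom c ((n - 1) * k)"
proof -
  have *: "monom d j = [:d:] * monom 1 1 ^ j" for d :: 'a and j
    by (simp add: monom_power smult_monom)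
  have "recip n (monom c k) = recip n [:c:] * recip n (monom 1 1) ^ k"
    by (simp only: *[of c k] recip_mult recip_power)
  also have "recip n [:c:] = [:c:]"
    by (simp add: recip_def)
  also have "recip n (monom 1 1) = (monom 1 (n - 1) :: 'a poly)"
    by (simp add: recip_def monom_Suc pcompose_pCons)
  finally show ?thesis
    by (simp add: monom_power smult_monom)
qed

lemma recip_sum: "recip n (\<Sum>i\<in>I. f i) = (\<Sum>i\<in>I. recip n (f i))"
  by (simp add: recip_def pcompose_sum)

lemma monom_n_cong_1: "[monom (1::'k::field) n = 1] (mod monom 1 n - 1)"
  by (simp add: cong_iff_dvd_diff)

lemma monom_cong:
  fixes c :: "'k::field"
  assumes "k mod n = l mod n"
  shows "[monom c k = monom c l] (mod monom 1 n - 1)"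
proof -
  have *: "[monom c k = monom c (k mod n)] (mod monom 1 n - 1)" for k
  proof -
    have "monom c k = monom c (k mod n) * monom 1 n ^ (k div n)"
      by (simp add: monom_power mult_monom)
    moreover have "[monom c (k mod n) * monom 1 n ^ (k div n) = monom c (k mod n) * 1 ^ (k div n)] (mod monom 1 n - 1)"
      by (intro cong_mult cong_pow monom_n_cong_1 cong_refl)
    ultimately show ?thesis by simp
  qed
  show ?thesis
    using *[of k] *[of l] assms by (metis cong_sym cong_trans)
qed

text \<open>The exponent \<open>m + (n - 1) * i\<close> exceeds \<open>m - i\<close> by
  \<open>n * i\<close>. This links the ring homomorphism \<open>recip\<close> to reversal of
  coefficient sequences.\<close>

lemma monom_mult_recip_cong:
  fixes A :: "'k::field poly"
  assumes "n > 0" and "degree A \<le> m"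
  shows "[monom 1 m * recip n A = rev_window m A] (mod monom 1 n - 1)"
proof -
  have "monom 1 m * recip n A = (\<Sum>i\<le>m. monom (coeff A i) (m + (n - 1) * i))"
    by (subst poly_as_sum_of_monoms_ge[OF assms(2)])
      (simp add: recip_sum recip_monom sum_distrib_left mult_monom)
  also have "[\<dots> = rev_window m A] (mod monom 1 n - 1)"
    unfolding rev_window_def
  proof (intro cong_sum monom_cong)
    fix i assume "i \<in> {..m}"
    then have "m + (n - 1) * i = (m - i) + n * i"
      using assms(1) by (cases n) auto
    then show "(m + (n - 1) * i) mod n = (m - i) mod n" by simp
  qed
  finally show ?thesis .
qed

text \<open>A common divisor of \<open>x\<close> and \<open>x ^ n - 1\<close> divides
  \<open>1\<close>. Hence \<open>x\<close> is a unit modulo every divisor of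
  \<open>x ^ n - 1\<close>, and shifts by powers of \<open>x\<close> can be undone.\<close>

lemma coprime_monom_of_dvd:
  fixes H :: "'k::field_gcd poly"
  assumes "n > 0" and "H dvd monom 1 n - 1"
  shows "coprime (monom 1 k) H"
proof -
  have "coprime (monom 1 1 :: 'k poly) (monom 1 n - 1)"
  proof (rule coprimeI)
    fix c :: "'k poly" assume c: "c dvd monom 1 1" "c dvd monom 1 n - 1"
    have "monom (1::'k) 1 dvd monom 1 n"
      using assms(1) by (intro dvdI[of _ _ "monom 1 (n - 1)"]) (simp add: mult_monom)
    with c have "c dvd monom 1 n - (monom 1 n - 1)" by (meson dvd_diff dvd_trans)
    then show "is_unit c" by simp
  qed
  then have "coprime (monom 1 1 ^ k) H"
    using assms(2) by (meson coprime_power_left_iff coprime_divisors dvd_refl)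
  then show ?thesis by (simp add: monom_power)
qed

lemma monom_mult_cancel_cong:
  fixes H :: "'k::field_gcd poly"
  assumes "n > 0" and "H dvd monom 1 n - 1"
    and "[monom 1 k * A = monom 1 k * B] (mod H)"
  shows "[A = B] (mod H)"
proof -
  have "H dvd monom 1 k * (A - B)"
    using assms(3) by (simp add: cong_iff_dvd_diff algebra_simps)
  then show ?thesis
    using coprime_monom_of_dvd[OF assms(1,2), of k]
    by (simp add: cong_iff_dvd_diff coprime_commute coprime_dvd_mult_right_iff)
qed

text \<open>Modulo \<open>H\<close> and up to the unit \<open>x ^ degree H\<close>,
  \<open>recip n H\<close> is the reciprocal of \<open>H\<close>, a multiple of \<open>H\<close>.
  Inversion is therefore well defined modulo \<open>H\<close>. The constant \<open>c\<close> admits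
  \<open>x - 1\<close>, whose reciprocal is its negative.\<close>

lemma dvd_recip_self:
  fixes H :: "'k::field_gcd poly"
  assumes "n > 0" and "H dvd monom 1 n - 1" and "reflect_poly H = smult c H"
  shows "H dvd recip n H"
proof -
  have "[monom 1 (degree H) * recip n H = reflect_poly H] (mod H)"
    using monom_mult_recip_cong[OF assms(1) order.refl, of H] assms(2)
    by (auto simp: rev_window_degree intro: cong_dvd_modulus)
  then have "[monom 1 (degree H) * recip n H = monom 1 (degree H) * 0] (mod H)"
    using assms(3) by (metis cong_0_iff cong_trans dvd_refl dvd_smult mult_zero_right)
  then have "[recip n H = 0] (mod H)"
    by (rule monom_mult_cancel_cong[OF assms(1,2)])
  then show ?thesis by (simp add: cong_0_iff)
qed

lemma recip_cong:
  fixes H :: "'k::field poly"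
  assumes "H dvd recip n H" and "[A = B] (mod H)"
  shows "[recip n A = recip n B] (mod H)"
proof -
  from assms(2) obtain Q where "A - B = H * Q" unfolding cong_iff_dvd_diff by (elim dvdE)
  then have "recip n A - recip n B = recip n H * recip n Q"
    by (metis recip_diff recip_mult)
  then show ?thesis using assms(1) by (simp add: cong_iff_dvd_diff)
qed

section \<open>Counting fixed residues through palindromes\<close>

definition sym_residues :: "nat \<Rightarrow> 'k::field poly \<Rightarrow> 'k poly set" where
  "sym_residues n H = {A. A mod H = A \<and> [recip n A = A] (mod H)}"

lemma mod_eq_self_iff_coeff:
  fixes H :: "'k::field poly"
  assumes "H \<noteq> 0"
  shows "A mod H = A \<longleftrightarrow> (\<forall>i\<ge>degree H. coeff A i = 0)"
proof
  assume "A mod H = A"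
  then have "A = 0 \<or> degree A < degree H"
    using degree_mod_less[OF assms, of A] by simp
  then show "\<forall>i\<ge>degree H. coeff A i = 0"
    by (auto simp: coeff_eq_0)
next
  assume *: "\<forall>i\<ge>degree H. coeff A i = 0"
  show "A mod H = A"
  proof (cases "A = 0")
    case False
    then have "degree A < degree H"
      using * by (metis leading_coeff_0_iff not_le)
    then show ?thesis by (rule mod_poly_less)
  qed simp
qed

lemma monom_minus_1_nonzero: "n > 0 \<Longrightarrow> monom (1::'k::field) n - 1 \<noteq> 0"
  using degree_monom_eq[of "1::'k" n] by fastforce

lemma sym_residues_0: "H dvd recip n H \<Longrightarrow> 0 \<in> sym_residues n H"
  by (simp add: sym_residues_def)

lemma degree_monom_minus_1:
  assumes "n > 0"
  shows "degree (monom 1 n - 1 :: 'k::field poly) = n"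
proof -
  have "degree (monom 1 n + (- 1) :: 'k poly) = degree (monom (1 :: 'k) n)"
    by (rule degree_add_eq_left) (simp add: degree_monom_eq assms)
  then show ?thesis by (simp add: degree_monom_eq)
qed

text \<open>A sequence symmetric about \<open>e\<close> is determined by its first half. For odd
  \<open>d\<close> the positions \<open>0..e\<close> are free. For even \<open>d\<close> the mirror
  image of \<open>0\<close> is \<open>2 * e = d\<close>, where the coefficient vanishes, so only
  \<open>1..e\<close> are free.\<close>

lemma card_palindromic_polys:
  fixes d :: nat
  defines "e \<equiv> d div 2"
  shows "card {P :: 'k::{field,finite} poly. (\<forall>i\<ge>d. coeff P i = 0) \<and> (\<forall>i\<le>2*e. coeff P i = coeff P (2*e - i))}
    = CARD('k) ^ ((d + 1) div 2)"
    (is "card ?T = _")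
proof -
  \<comment> \<open>The first free position: \<open>1\<close> for even \<open>d\<close> and
    \<open>0\<close> for odd \<open>d\<close>.\<close>
  define lo where "lo = 2 * e + 1 - d"
  have d: "d = 2 * e + 1 - lo" "lo \<le> 1" "(d + 1) div 2 = e + 1 - lo"
    unfolding e_def lo_def by presburger+
  define f where "f = (\<lambda>P :: 'k poly. restrict (coeff P) {lo..e})"
  define g where "g = (\<lambda>a :: nat \<Rightarrow> 'k. \<Sum>i\<in>{lo..<d}. monom (a (if i \<le> e then i else 2 * e - i)) i)"
  have cg: "coeff (g a) j = (if lo \<le> j \<and> j < d then a (if j \<le> e then j else 2 * e - j) else 0)" for a j
    by (simp add: g_def coeff_sum)
  have "bij_betw f ?T ({lo..e} \<rightarrow>\<^sub>E UNIV)"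
  proof (rule bij_betw_byWitness[where f' = g])
    show "\<forall>P\<in>?T. g (f P) = P"
    proof
      fix P assume P: "P \<in> ?T"
      show "g (f P) = P"
      proof (rule poly_eqI)
        fix j
        show "coeff (g (f P)) j = coeff P j"
        proof (cases "lo \<le> j \<and> j < d")
          case True
          then have j: "j \<le> 2 * e" "2 * e - j \<ge> lo" using d by linarith+
          have "coeff P j = coeff P (2 * e - j)" using P j by blast
          then show ?thesis using True j by (auto simp: cg f_def)
        next
          case False
          then consider "j \<ge> d" | "j = 0" "lo = 1" using d by linarith
          then show ?thesis
          proof cases
            case 1
            then show ?thesis using P False by (simp add: cg)
          next
            case 2
            then have "d \<le> 2 * e" using d by linarith
            then have "coeff P (2 * e) = 0" using P by blast
            moreover have "coeff P 0 = coeff P (2 * e - 0)" using P by blast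
            ultimately show ?thesis using 2 by (simp add: cg)
          qed
        qed
      qed
    qed
    show "\<forall>a\<in>{lo..e} \<rightarrow>\<^sub>E UNIV. f (g a) = a"
    proof
      fix a :: "nat \<Rightarrow> 'k" assume a: "a \<in> {lo..e} \<rightarrow>\<^sub>E UNIV"
      show "f (g a) = a"
      proof
        fix j
        show "f (g a) j = a j"
        proof (cases "j \<in> {lo..e}")
          case True
          then have "j < d" using d by (cases "lo = 0") auto
          then show ?thesis using True by (simp add: f_def cg)
        next
          case False
          then show ?thesis using PiE_arb[OF a False] False by (simp only: f_def restrict_def if_False)
        qed
      qed
    qed
    show "f ` ?T \<subseteq> {lo..e} \<rightarrow>\<^sub>E UNIV"
    proof (rule image_subsetI)
      show "f P \<in> {lo..e} \<rightarrow>\<^sub>E UNIV" for P by (simp add: f_def)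
    qed
    show "g ` ({lo..e} \<rightarrow>\<^sub>E UNIV) \<subseteq> ?T"
    proof (intro image_subsetI CollectI conjI allI impI)
      fix a :: "nat \<Rightarrow> 'k" and j
      show "coeff (g a) j = 0" if "j \<ge> d" using that by (simp add: cg)
      show "coeff (g a) j = coeff (g a) (2 * e - j)" if "j \<le> 2 * e"
      proof -
        have "(lo \<le> j \<and> j < d) = (lo \<le> 2 * e - j \<and> 2 * e - j < d)"
        proof -
          consider "lo = 0" "d = Suc (2 * e)" | "lo = 1" "d = 2 * e"
            using d by linarith
          then show ?thesis using that by cases auto
        qed
        moreover have "2 * e - (2 * e - j) = j" using that by simp
        moreover have "j = e" if "j \<le> e" "2 * e - j \<le> e" using that by linarith
        moreover have "j = 2 * e - j \<or> j \<le> e \<or> 2 * e - j \<le> e" by linarith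
        ultimately show ?thesis unfolding cg by auto
      qed
    qed
  qed
  then have "card ?T = card ({lo..e} \<rightarrow>\<^sub>E (UNIV :: 'k set))"
    by (rule bij_betw_same_card)
  also have "\<dots> = CARD('k) ^ (e + 1 - lo)"
    by (subst card_PiE) (auto simp: prod_constant)
  finally show ?thesis using d by simp
qed

text \<open>The difference of the two sides has degree at most \<open>2 * e\<close>, so if it is a
  nonzero multiple of \<open>H\<close> it is a scalar multiple, with
  \<open>degree H = 2 * e\<close>. Then \<open>c = 1\<close> makes it symmetric under reversal,
  whereas the difference is antisymmetric; this is impossible when \<open>2\<close> is
  invertible.\<close>

lemma rev_window_cong_iff:
  fixes H :: "'k::field poly"
  assumes "(2::'k) \<noteq> 0" and "H \<noteq> 0" and refl: "reflect_poly H = smult c H" and "even (degree H) \<Longrightarrow> c = 1"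
    and P: "\<forall>i\<ge>degree H. coeff P i = 0" and e: "e = degree H div 2"
  shows "[rev_window (2 * e) P = P] (mod H) \<longleftrightarrow> (\<forall>i\<le>2*e. coeff P i = coeff P (2*e - i))"
proof
  define d where "d = degree H"
  have d: "d \<le> 2 * e + 1" "2 * e \<le> d" using e unfolding d_def by presburger+
  have degP: "degree P \<le> 2 * e"
    by (rule degree_le) (use P d d_def in auto)
  {
    define D where "D = rev_window (2 * e) P - P"
    assume "[rev_window (2 * e) P = P] (mod H)"
    then have HD: "H dvd D" by (simp add: D_def cong_iff_dvd_diff)
    have degD: "degree D \<le> 2 * e"
      unfolding D_def by (intro degree_diff_le degree_rev_window degP)
    have "D = 0"
    proof (rule ccontr)
      assume D0: "D \<noteq> 0"
      with HD have "degree H \<le> degree D" by (rule dvd_imp_degree_le)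
      then have dd: "d = 2 * e" "degree D = d" using degD d d_def by linarith+
      obtain Q where Q: "D = H * Q" using HD by (elim dvdE)
      with D0 have "H \<noteq> 0" "Q \<noteq> 0" by auto
      then have "degree Q = 0" using dd Q d_def by (simp add: degree_mult_eq)
      then obtain t where "Q = [:t:]" by (metis degree_eq_zeroE)
      then have D: "D = smult t H" using Q by simp
      have c: "c = 1" using assms(4) dd d_def by simp
      have "rev_window (2 * e) H = H"
        using rev_window_degree[of H] refl c dd d_def by simp
      then have "rev_window (2 * e) D = D" by (simp add: D rev_window_smult)
      moreover have "rev_window (2 * e) D = - D"
        unfolding D_def using degP by (simp add: rev_window_diff rev_window_rev_window)
      ultimately have "D = - D" by simp
      then have "D + D = 0" by (simp only: eq_neg_iff_add_eq_0)
      moreover have "smult 2 D = D + D"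
        by (rule poly_eqI) (simp only: coeff_smult coeff_add mult_2)
      ultimately have "smult 2 D = 0" by (simp only:)
      then show False using assms(1) D0 by simp
    qed
    then have eq: "rev_window (2 * e) P = P" by (simp add: D_def)
    show "\<forall>i\<le>2*e. coeff P i = coeff P (2*e - i)"
    proof (intro allI impI)
      fix i assume "i \<le> 2 * e"
      then show "coeff P i = coeff P (2 * e - i)"
        using arg_cong[OF eq, of "\<lambda>Q. coeff Q i"] by (simp add: coeff_rev_window)
    qed
  }
  assume *: "\<forall>i\<le>2*e. coeff P i = coeff P (2*e - i)"
  have "rev_window (2 * e) P = P"
  proof (rule poly_eqI)
    fix i show "coeff (rev_window (2 * e) P) i = coeff P i"
    proof (cases "i \<le> 2 * e")
      case True
      then have "coeff P i = coeff P (2 * e - i)" using * by blast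
      then show ?thesis using True by (simp add: coeff_rev_window)
    next
      case False
      then show ?thesis using degP by (simp add: coeff_rev_window coeff_eq_0)
    qed
  qed
  then show "[rev_window (2 * e) P = P] (mod H)" by simp
qed

text \<open>Invariance under \<open>x \<mapsto> 1/x\<close> is symmetry about exponent
  \<open>0\<close>; multiplication by \<open>x ^ e\<close> moves the centre to \<open>e\<close>,
  where the symmetry can be read off from coefficients.\<close>

lemma shift_sym_cong_iff:
  fixes H :: "'k::field_gcd poly"
  assumes n: "n > 0" and H: "H dvd monom 1 n - 1" "H dvd recip n H"
    and P: "[P = monom 1 e * A] (mod H)"
  shows "[recip n A = A] (mod H) \<longleftrightarrow> [monom 1 (2 * e) * recip n P = P] (mod H)"
proof -
  have "[monom 1 (2 * e) * recip n P = monom 1 (2 * e) * recip n (monom 1 e * A)] (mod H)"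
    by (intro cong_mult cong_refl recip_cong H P)
  also have "monom 1 (2 * e) * recip n (monom 1 e * A) = monom 1 (2 * e + (n - 1) * e) * recip n A"
    by (simp add: recip_mult recip_monom mult_monom flip: mult.assoc)
  also have "[\<dots> = monom 1 e * recip n A] (mod H)"
  proof (intro cong_mult cong_refl cong_dvd_modulus[OF monom_cong H(1)])
    have "2 * e + (n - 1) * e = e + n * e" using n by (cases n) auto
    then show "(2 * e + (n - 1) * e) mod n = e mod n" by (simp only: mod_mult_self2)
  qed
  finally have *: "[monom 1 (2 * e) * recip n P = monom 1 e * recip n A] (mod H)" .
  show ?thesis
  proof
    assume "[recip n A = A] (mod H)"
    then have "[monom 1 e * recip n A = monom 1 e * A] (mod H)"
      by (intro cong_mult cong_refl)
    then show "[monom 1 (2 * e) * recip n P = P] (mod H)"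
      using * P by (metis cong_sym cong_trans)
  next
    assume "[monom 1 (2 * e) * recip n P = P] (mod H)"
    then have "[monom 1 e * recip n A = monom 1 e * A] (mod H)"
      using * P by (metis cong_sym cong_trans)
    then show "[recip n A = A] (mod H)"
      by (rule monom_mult_cancel_cong[OF n H(1)])
  qed
qed

text \<open>Multiplication by the unit \<open>x ^ e\<close>, with \<open>e\<close> half the degree
  rounded down, carries fixed residues to palindromes. The condition on \<open>c\<close> matters:
  modulo \<open>x ^ 2 - 1\<close>, whose reciprocal is its negative, every residue is fixed.\<close>

lemma card_sym_residues:
  fixes H :: "'k::{field_gcd,finite} poly"
  assumes n: "n > 0" and two: "(2::'k) \<noteq> 0" and H: "H dvd monom 1 n - 1"
    and refl: "reflect_poly H = smult c H" and ev: "even (degree H) \<Longrightarrow> c = 1"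
  shows "card (sym_residues n H) = CARD('k) ^ ((degree H + 1) div 2)"
proof -
  define e where "e = degree H div 2"
  have H0: "H \<noteq> 0" using H monom_minus_1_nonzero[OF n] by auto
  have HH: "H dvd recip n H" by (rule dvd_recip_self[OF n H refl])
  define T where "T = {P :: 'k poly. (\<forall>i\<ge>degree H. coeff P i = 0) \<and> (\<forall>i\<le>2*e. coeff P i = coeff P (2*e - i))}"
  have T_iff: "P \<in> T \<longleftrightarrow> P mod H = P \<and> [monom 1 (2 * e) * recip n P = P] (mod H)" for P
  proof (cases "P mod H = P")
    case True
    then have P: "\<forall>i\<ge>degree H. coeff P i = 0" by (simp add: mod_eq_self_iff_coeff[OF H0])
    have "degree P \<le> 2 * e"
    proof (rule degree_le, intro allI impI)
      fix i assume "2 * e < i"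
      then have "degree H \<le> i" unfolding e_def by presburger
      then show "coeff P i = 0" using P by simp
    qed
    then have "[monom 1 (2 * e) * recip n P = rev_window (2 * e) P] (mod H)"
      by (intro cong_dvd_modulus[OF monom_mult_recip_cong H] n)
    then have "[monom 1 (2 * e) * recip n P = P] (mod H) \<longleftrightarrow> [rev_window (2 * e) P = P] (mod H)"
      by (metis cong_sym cong_trans)
    then show ?thesis
      using True P rev_window_cong_iff[OF two H0 refl ev P e_def] by (simp add: T_def)
  next
    case False
    then have "P \<notin> T" unfolding T_def mod_eq_self_iff_coeff[OF H0] by blast
    then show ?thesis using False by blast
  qed
  define f where "f = (\<lambda>A :: 'k poly. (monom 1 e * A) mod H)"
  \<comment> \<open>\<open>x ^ ((n - 1) * e)\<close> inverts \<open>x ^ e\<close>, since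
    \<open>x ^ (n * e)\<close> is \<open>1\<close> modulo \<open>H\<close>.\<close>
  define g where "g = (\<lambda>P :: 'k poly. (monom 1 ((n - 1) * e) * P) mod H)"
  have inv: "[monom 1 e * (monom 1 ((n - 1) * e) * P) = P] (mod H)" for P
  proof -
    have "monom 1 e * (monom 1 ((n - 1) * e) * P) = monom 1 (n * e) * P"
      using n by (cases n) (simp_all add: mult_monom flip: mult.assoc)
    also have "[\<dots> = monom 1 0 * P] (mod H)"
      by (intro cong_mult cong_refl cong_dvd_modulus[OF monom_cong H]) simp
    finally show ?thesis by simp
  qed
  have "bij_betw f (sym_residues n H) T"
  proof (rule bij_betw_byWitness[where f' = g])
    show "\<forall>A\<in>sym_residues n H. g (f A) = A"
    proof
      fix A assume "A \<in> sym_residues n H"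
      then have A: "A mod H = A" by (simp add: sym_residues_def)
      have "g (f A) = (monom 1 e * (monom 1 ((n - 1) * e) * A)) mod H"
        unfolding f_def g_def by (simp only: mod_mult_right_eq mult.left_commute)
      then show "g (f A) = A" using inv[of A] A by (simp add: cong_def)
    qed
    show "\<forall>P\<in>T. f (g P) = P"
    proof
      fix P assume "P \<in> T"
      then have P: "P mod H = P" by (simp add: T_iff)
      have "f (g P) = (monom 1 e * (monom 1 ((n - 1) * e) * P)) mod H"
        unfolding f_def g_def by (simp add: mod_mult_right_eq)
      then show "f (g P) = P" using inv[of P] P by (simp add: cong_def)
    qed
    show "f ` sym_residues n H \<subseteq> T"
    proof
      fix P assume "P \<in> f ` sym_residues n H"
      then obtain A where "A \<in> sym_residues n H" "P = f A" by blast
      moreover have "[f A = monom 1 e * A] (mod H)" by (simp add: f_def cong_def)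
      ultimately show "P \<in> T"
        using shift_sym_cong_iff[OF n H HH] by (simp add: T_iff sym_residues_def f_def)
    qed
    show "g ` T \<subseteq> sym_residues n H"
    proof
      fix A assume "A \<in> g ` T"
      then obtain P where P: "P \<in> T" "A = g P" by blast
      have "[g P = monom 1 ((n - 1) * e) * P] (mod H)" by (simp add: g_def cong_def)
      then have "[monom 1 e * g P = monom 1 e * (monom 1 ((n - 1) * e) * P)] (mod H)"
        by (intro cong_mult cong_refl)
      with inv[of P] have "[P = monom 1 e * A] (mod H)" using P by (metis cong_sym cong_trans)
      from shift_sym_cong_iff[OF n H HH this] P show "A \<in> sym_residues n H"
        by (simp add: T_iff sym_residues_def g_def)
    qed
  qed
  then have "card (sym_residues n H) = card T"
    by (rule bij_betw_same_card)
  then show ?thesis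
    using card_palindromic_polys[where 'k = 'k, of "degree H"] by (simp add: T_def e_def)
qed

section \<open>The generating function of fixed residues\<close>

text \<open>The exponent is the dimension of the ideal generated by \<open>A\<close> in the quotient
  by \<open>H\<close>. For \<open>H = x ^ n - 1\<close> the exponent \<open>t\<close> belongs to the
  \<open>(n - t)\<close>-plateaued functions.\<close>

definition sym_gf :: "nat \<Rightarrow> 'k::field_gcd poly \<Rightarrow> int poly" where
  "sym_gf n H = (\<Sum>A\<in>sym_residues n H. monom 1 (degree H - degree (gcd A H)))"

lemma finite_sym_residues:
  fixes H :: "'k::{field,finite} poly"
  assumes "H \<noteq> 0"
  shows "finite (sym_residues n H)"
proof (rule finite_subset)
  show "sym_residues n H \<subseteq> (\<lambda>a. \<Sum>i<degree H. monom (a i) i) ` ({..<degree H} \<rightarrow>\<^sub>E (UNIV :: 'k set))"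
  proof
    fix A assume "A \<in> sym_residues n H"
    then have "\<forall>i\<ge>degree H. coeff A i = 0"
      using mod_eq_self_iff_coeff[OF assms] by (simp add: sym_residues_def)
    then have "A = (\<Sum>i<degree H. monom (restrict (coeff A) {..<degree H} i) i)"
      by (intro poly_eqI) (auto simp: coeff_sum)
    then show "A \<in> (\<lambda>a. \<Sum>i<degree H. monom (a i) i) ` ({..<degree H} \<rightarrow>\<^sub>E UNIV)"
      by (rule image_eqI[where x = "restrict (coeff A) {..<degree H}"]) simp
  qed
  show "finite ((\<lambda>a. \<Sum>i<degree H. monom (a i) i) ` ({..<degree H} \<rightarrow>\<^sub>E (UNIV :: 'k set)))"
    by (intro finite_imageI finite_PiE) auto
qed

lemma gcd_mult_coprime:
  fixes a :: "'k::field_gcd poly"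
  assumes "coprime b c"
  shows "gcd a (b * c) = gcd a b * gcd a c"
proof (rule associated_eqI)
  obtain b' c' where bc: "gcd a (b * c) = b' * c'" "b' dvd b" "c' dvd c"
    using division_decomp[of "gcd a (b * c)" b c] by auto
  have "b' dvd a" "c' dvd a"
    by (metis bc(1) dvd_trans dvd_triv_left gcd_dvd1) (metis bc(1) dvd_trans dvd_triv_right gcd_dvd1)
  then show "gcd a (b * c) dvd gcd a b * gcd a c"
    unfolding bc(1) using bc by (intro mult_dvd_mono) auto
  have "coprime (gcd a b) (gcd a c)"
    using assms by (meson coprime_divisors gcd_dvd2)
  then have "gcd a b * gcd a c dvd a" by (intro divides_mult) auto
  then show "gcd a b * gcd a c dvd gcd a (b * c)"
    by (intro gcd_greatest mult_dvd_mono) auto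
qed (simp_all add: normalize_mult)

lemma chinese_remainder_poly:
  fixes f :: "'k::field_gcd poly"
  assumes "coprime f g"
  shows "\<exists>X. [X = s] (mod f) \<and> [X = t] (mod g)"
proof -
  define u v where "u = fst (bezout_coefficients f g)" and "v = snd (bezout_coefficients f g)"
  have uv: "u * f + v * g = 1"
    using bezout_coefficients_fst_snd[of f g] assms by (simp add: u_def v_def)
  define X where "X = t * (u * f) + s * (v * g)"
  \<comment> \<open>The second summands are zero by \<open>uv\<close>; with them included, the
    identities hold for arbitrary \<open>u\<close> and \<open>v\<close>.\<close>
  have "X - s = f * (u * (t - s)) + s * (u * f + v * g - 1)" "X - t = g * (v * (s - t)) + t * (u * f + v * g - 1)"
    by (simp_all add: X_def algebra_simps)
  then have "X - s = f * (u * (t - s))" "X - t = g * (v * (s - t))"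
    by (simp_all add: uv)
  then have "f dvd X - s" "g dvd X - t" by (metis dvd_triv_left)+
  then show ?thesis unfolding cong_iff_dvd_diff by blast
qed

text \<open>Inversion is well defined modulo \<open>f\<close> and modulo \<open>g\<close>, so the
  Chinese remainder map commutes with it and matches fixed residues with pairs of fixed residues.
  Gcd degrees add over coprime moduli, which makes the monomials multiply.\<close>

lemma sym_gf_mult:
  fixes f :: "'k::{field_gcd,finite} poly"
  assumes cop: "coprime f g" and nz: "f \<noteq> 0" "g \<noteq> 0"
    and rc: "f dvd recip n f" "g dvd recip n g"
  shows "sym_gf n (f * g) = sym_gf n f * sym_gf n g"
proof -
  define h where "h = (\<lambda>A :: 'k poly. (A mod f, A mod g))"
  have mem: "A mod f \<in> sym_residues n f \<and> A mod g \<in> sym_residues n g \<longleftrightarrow> [recip n A = A] (mod (f * g))" for A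
  proof -
    have *: "A mod k \<in> sym_residues n k \<longleftrightarrow> [recip n A = A] (mod k)" if "k dvd recip n k" for k
    proof -
      have "[recip n (A mod k) = recip n A] (mod k)"
        by (rule recip_cong[OF that]) (simp add: cong_def)
      then show ?thesis
        by (simp add: sym_residues_def cong_def)
    qed
    show ?thesis
      unfolding *[OF rc(1)] *[OF rc(2)]
      by (rule iffI, (erule conjE, rule coprime_cong_mult[OF _ _ cop]; assumption),
          rule conjI; erule cong_dvd_modulus; simp)
  qed
  have bij: "bij_betw h (sym_residues n (f * g)) (sym_residues n f \<times> sym_residues n g)"
  proof (intro bij_betwI')
    fix A B assume AB: "A \<in> sym_residues n (f * g)" "B \<in> sym_residues n (f * g)"
    show "(h A = h B) = (A = B)"
    proof
      assume "h A = h B"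
      then have "[A = B] (mod (f * g))"
        by (intro coprime_cong_mult[OF _ _ cop]) (simp_all add: h_def cong_def)
      then show "A = B" using AB by (simp add: sym_residues_def cong_def)
    qed simp
  next
    fix A assume "A \<in> sym_residues n (f * g)"
    then show "h A \<in> sym_residues n f \<times> sym_residues n g"
      using mem[of A] by (simp add: h_def sym_residues_def)
  next
    fix BC assume "BC \<in> sym_residues n f \<times> sym_residues n g"
    then obtain B C where BC: "BC = (B, C)" "B \<in> sym_residues n f" "C \<in> sym_residues n g" by blast
    obtain X where X: "[X = B] (mod f)" "[X = C] (mod g)"
      using chinese_remainder_poly[OF cop] by blast
    define A where "A = X mod (f * g)"
    have A: "A mod f = B" "A mod g = C"
      using X BC by (simp_all add: A_def sym_residues_def cong_def mod_mod_cancel)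
    then have "[recip n A = A] (mod (f * g))" using mem BC by blast
    then have "A \<in> sym_residues n (f * g)" by (simp add: sym_residues_def A_def)
    then show "\<exists>A\<in>sym_residues n (f * g). BC = h A"
      using A BC by (auto simp: h_def)
  qed
  have "sym_gf n (f * g) = (\<Sum>A\<in>sym_residues n (f * g).
      (\<lambda>(B, C). monom 1 (degree f - degree (gcd B f)) * monom 1 (degree g - degree (gcd C g))) (h A))"
    unfolding sym_gf_def
  proof (rule sum.cong[OF refl])
    fix A
    have nz': "gcd A f \<noteq> 0" "gcd A g \<noteq> 0" using nz by auto
    have le: "degree (gcd A f) \<le> degree f" "degree (gcd A g) \<le> degree g"
      using nz by (auto intro: dvd_imp_degree_le)
    have "degree (f * g) - degree (gcd A (f * g)) =
        (degree f - degree (gcd A f)) + (degree g - degree (gcd A g))"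
      unfolding gcd_mult_coprime[OF cop] using nz nz' le by (simp add: degree_mult_eq)
    then show "monom (1::int) (degree (f * g) - degree (gcd A (f * g))) =
        (\<lambda>(B, C). monom 1 (degree f - degree (gcd B f)) * monom 1 (degree g - degree (gcd C g))) (h A)"
      by (simp add: h_def mult_monom gcd_mod_left nz)
  qed
  also have "\<dots> = (\<Sum>(B, C)\<in>sym_residues n f \<times> sym_residues n g.
      monom 1 (degree f - degree (gcd B f)) * monom 1 (degree g - degree (gcd C g)))"
    by (rule sum.reindex_bij_betw[OF bij])
  also have "\<dots> = sym_gf n f * sym_gf n g"
    by (simp add: sym_gf_def sum_product sum.cartesian_product)
  finally show ?thesis .
qed

lemma sym_gf_1: "sym_gf n (1 :: 'k::field_gcd poly) = 1"
proof -
  have "sym_residues n (1 :: 'k poly) = {0}" by (auto simp: sym_residues_def)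
  then show ?thesis by (simp add: sym_gf_def)
qed

lemma sym_gf_prod:
  fixes f :: "'i \<Rightarrow> 'k::{field_gcd,finite} poly"
  assumes "finite I" and "\<And>i j. i \<in> I \<Longrightarrow> j \<in> I \<Longrightarrow> i \<noteq> j \<Longrightarrow> coprime (f i) (f j)"
    and "\<And>i. i \<in> I \<Longrightarrow> f i \<noteq> 0" and "\<And>i. i \<in> I \<Longrightarrow> f i dvd recip n (f i)"
  shows "sym_gf n (\<Prod>i\<in>I. f i) = (\<Prod>i\<in>I. sym_gf n (f i))"
  using assms
proof (induction I)
  case empty
  then show ?case by (simp add: sym_gf_1)
next
  case (insert i I)
  have "recip n (\<Prod>i\<in>I. f i) = (\<Prod>i\<in>I. recip n (f i))"
    by (simp add: recip_def pcompose_prod)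
  moreover have "(\<Prod>i\<in>I. f i) dvd (\<Prod>i\<in>I. recip n (f i))"
    by (rule prod_dvd_prod) (use insert.prems in auto)
  ultimately have dvd: "(\<Prod>i\<in>I. f i) dvd recip n (\<Prod>i\<in>I. f i)" by simp
  have "coprime (f i) (\<Prod>i\<in>I. f i)"
    by (rule prod_coprime_right) (use insert in auto)
  then have "sym_gf n (f i * (\<Prod>i\<in>I. f i)) = sym_gf n (f i) * sym_gf n (\<Prod>i\<in>I. f i)"
    by (intro sym_gf_mult dvd) (use insert in auto)
  then show ?case using insert by simp
qed

section \<open>Fixed residues divisible by a power of a factor\<close>

text \<open>Shifting the palindrome \<open>D\<close> by half its even degree gives an element
  \<open>rho\<close> that is itself fixed by inversion. Multiplication by \<open>rho\<close> embeds
  the residues modulo \<open>G\<close> as the multiples of \<open>D\<close> modulo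
  \<open>D * G\<close>, and preserves being fixed in both directions.\<close>

lemma card_sym_residues_multiples:
  fixes D :: "'k::{field_gcd,finite} poly"
  assumes n: "n > 0" and two: "(2::'k) \<noteq> 0" and DG: "D * G dvd monom 1 n - 1"
    and D: "reflect_poly D = D" "even (degree D)"
    and G: "reflect_poly G = smult c G" "even (degree G) \<Longrightarrow> c = 1"
  shows "card {A \<in> sym_residues n (D * G). D dvd A} = CARD('k) ^ ((degree G + 1) div 2)"
proof -
  obtain e where e: "degree D = 2 * e" using D(2) by (elim evenE)
  define rho where "rho = monom 1 ((n - 1) * e) * D"
  define f where "f = (\<lambda>C :: 'k poly. (rho * C) mod (D * G))"
  have nz: "D \<noteq> 0" "G \<noteq> 0" using DG monom_minus_1_nonzero[OF n, where ?'k = 'k] by auto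
  have Gdvd: "G dvd monom 1 n - 1" using DG by (metis dvd_mult_right)
  have "reflect_poly (D * G) = smult c (D * G)" using D(1) G(1) by (simp add: reflect_poly_mult)
  note DGr = dvd_recip_self[OF n DG this]
  have rho_sym: "[recip n rho = rho] (mod (D * G))"
  proof (rule cong_dvd_modulus[OF _ DG])
    have *: "[monom 1 (2 * e) * recip n D = D] (mod monom 1 n - 1)"
      using monom_mult_recip_cong[OF n order.refl, of D] rev_window_degree[of D]
      by (simp only: e D(1))
    have "recip n rho = monom 1 ((n - 1) * ((n - 1) * e)) * recip n D"
      by (simp add: rho_def recip_mult recip_monom)
    also have "[\<dots> = monom 1 ((n - 1) * e + 2 * e) * recip n D] (mod monom 1 n - 1)"
    proof (intro cong_mult cong_refl monom_cong)
      obtain m where m: "n = Suc m" using n by (cases n) auto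
      \<comment> \<open>Both exponents are congruent to \<open>e\<close> modulo
        \<open>n\<close>.\<close>
      have "(n - 1) * e + 2 * e = e + n * e" by (simp add: m)
      moreover have "(n - 1) * ((n - 1) * e) + n * e * 2 = e + n * e * (m + 1)" by (simp add: m algebra_simps)
      ultimately show "((n - 1) * ((n - 1) * e)) mod n = ((n - 1) * e + 2 * e) mod n"
        by (metis mod_mult_self2 mult.assoc)
    qed
    also have "monom 1 ((n - 1) * e + 2 * e) * recip n D = monom 1 ((n - 1) * e) * (monom 1 (2 * e) * recip n D)"
      by (simp add: mult_monom flip: mult.assoc)
    also have "[\<dots> = rho] (mod monom 1 n - 1)"
      unfolding rho_def by (intro cong_mult cong_refl *)
    finally show "[recip n rho = rho] (mod monom 1 n - 1)" .
  qed
  have cancel: "[rho * B = rho * C] (mod (D * G)) \<longleftrightarrow> [B = C] (mod G)" for B C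
  proof -
    have "rho * B - rho * C = D * (monom 1 ((n - 1) * e) * (B - C))"
      by (simp add: rho_def algebra_simps)
    then have "[rho * B = rho * C] (mod (D * G)) \<longleftrightarrow> G dvd monom 1 ((n - 1) * e) * (B - C)"
      using nz by (simp add: cong_iff_dvd_diff del: mult_eq_0_iff)
    also have "\<dots> \<longleftrightarrow> [B = C] (mod G)"
      using coprime_monom_of_dvd[OF n Gdvd, of "(n - 1) * e"]
      by (simp add: cong_iff_dvd_diff coprime_commute coprime_dvd_mult_right_iff)
    finally show ?thesis .
  qed
  have sym_iff: "[recip n (rho * C) = rho * C] (mod (D * G)) \<longleftrightarrow> [recip n C = C] (mod G)" for C
  proof -
    have "[recip n (rho * C) = rho * recip n C] (mod (D * G))"
      unfolding recip_mult by (intro cong_mult cong_refl rho_sym)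
    then show ?thesis
      using cancel by (metis cong_sym cong_trans)
  qed
  have f_cong: "[f C = rho * C] (mod (D * G))" for C by (simp add: f_def cong_def)
  have f_sym: "[recip n (f C) = f C] (mod (D * G)) \<longleftrightarrow> [recip n C = C] (mod G)" for C
    using recip_cong[OF DGr f_cong[of C]] f_cong[of C] sym_iff[of C] by (metis cong_sym cong_trans)
  have "bij_betw f (sym_residues n G) {A \<in> sym_residues n (D * G). D dvd A}"
  proof (intro bij_betwI')
    fix B C assume BC: "B \<in> sym_residues n G" "C \<in> sym_residues n G"
    show "(f B = f C) = (B = C)"
      using cancel[of B C] BC by (auto simp: f_def cong_def sym_residues_def)
  next
    fix C assume C: "C \<in> sym_residues n G"
    have "D dvd f C"
      unfolding f_def by (rule dvd_mod) (simp_all add: rho_def)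
    then show "f C \<in> {A \<in> sym_residues n (D * G). D dvd A}"
      using f_sym[of C] C by (simp add: sym_residues_def f_def)
  next
    fix A assume A: "A \<in> {A \<in> sym_residues n (D * G). D dvd A}"
    then obtain B where B: "A = D * B" unfolding mem_Collect_eq by (elim conjE dvdE)
    \<comment> \<open>The factor \<open>x ^ e\<close> cancels the shift contained in
      \<open>rho\<close>.\<close>
    define C where "C = (monom 1 e * B) mod G"
    have "[rho * C = rho * (monom 1 e * B)] (mod (D * G))"
      unfolding cancel by (simp add: C_def cong_def)
    also have "rho * (monom 1 e * B) = monom 1 (n * e) * A"
      using n by (cases n) (simp_all add: rho_def B mult_monom mult_ac flip: mult.assoc)
    also have "[monom 1 (n * e) * A = monom 1 0 * A] (mod (D * G))"
      by (intro cong_mult cong_refl cong_dvd_modulus[OF monom_cong DG]) simp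
    finally have "[rho * C = A] (mod (D * G))" by simp
    then have fC: "f C = A" using A by (simp add: f_def cong_def sym_residues_def)
    have "C \<in> sym_residues n G"
      using f_sym[of C] A unfolding fC by (simp add: sym_residues_def C_def)
    then show "\<exists>C\<in>sym_residues n G. A = f C" using fC by blast
  qed
  then have "card {A \<in> sym_residues n (D * G). D dvd A} = card (sym_residues n G)"
    by (rule bij_betw_same_card[symmetric])
  then show ?thesis using card_sym_residues[OF n two Gdvd G] by simp
qed

lemma degree_normalize_poly: "degree (normalize (f :: 'k::field_gcd poly)) = degree f"
proof (cases "f = 0")
  case False
  then show ?thesis by (intro antisym dvd_imp_degree_le) simp_all
qed simp

text \<open>Residues are sorted by the exact power \<open>r ^ j\<close> dividing them; for
  \<open>j < m\<close> there are \<open>M j - M (j + 1)\<close> of them, and \<open>gc\<close> says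
  that the order determines the gcd degree. Only \<open>0\<close> is divisible by
  \<open>r ^ m\<close>, whence the constant term \<open>1\<close>. The index of the final sum is
  \<open>m\<close> minus the order. Keeping \<open>M\<close> abstract serves linear and even-degree
  factors alike.\<close>

lemma sym_gf_power:
  fixes r :: "'k::{field_gcd,finite} poly" and M :: "nat \<Rightarrow> nat"
  assumes r: "r \<noteq> 0" "degree r = d"
    and M: "\<And>j. j \<le> m \<Longrightarrow> card {A \<in> sym_residues n (r ^ m). r ^ j dvd A} = M j" and Mm: "M m = 1"
    and gc: "\<And>A j. A \<in> sym_residues n (r ^ m) \<Longrightarrow> j < m \<Longrightarrow> r ^ j dvd A \<Longrightarrow> \<not> r ^ Suc j dvd A \<Longrightarrow>
               degree (gcd A (r ^ m)) = d * j"
  shows "sym_gf n (r ^ m) = 1 + (\<Sum>j=1..m. monom (int (M (m - j)) - int (M (m - (j - 1)))) (d * j))"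
proof -
  define S where "S = sym_residues n (r ^ m)"
  \<comment> \<open>The bound \<open>j \<le> m\<close> assigns order \<open>m\<close> to the residue
    \<open>0\<close>, which every power divides.\<close>
  define key where "key = (\<lambda>A. GREATEST j. j \<le> m \<and> r ^ j dvd A)"
  define h where "h = (\<lambda>A. monom (1::int) (degree (r ^ m) - degree (gcd A (r ^ m))))"
  have finS: "finite S" unfolding S_def by (rule finite_sym_residues) (use r in simp)
  have key: "key A \<le> m \<and> r ^ key A dvd A" for A
    unfolding key_def by (rule GreatestI_nat[where k = 0 and b = m]) auto
  have key_ge: "j \<le> key A \<longleftrightarrow> r ^ j dvd A" if "j \<le> m" for j A
  proof
    assume "j \<le> key A"
    then show "r ^ j dvd A" using key[of A] by (meson dvd_trans le_imp_power_dvd)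
  next
    assume "r ^ j dvd A"
    then show "j \<le> key A"
      unfolding key_def by (intro Greatest_le_nat[where b = m]) (use that in auto)
  qed
  have h: "h A = monom 1 (d * (m - key A))" if "A \<in> S" for A
  proof (cases "key A < m")
    case True
    then have "r ^ key A dvd A" "\<not> r ^ Suc (key A) dvd A"
      using key[of A] key_ge[of "Suc (key A)" A] by auto
    then have "degree (gcd A (r ^ m)) = d * key A"
      using gc[of A "key A"] that True by (simp add: S_def)
    then show ?thesis
      using r by (simp add: h_def degree_power_eq diff_mult_distrib2 mult.commute)
  next
    case False
    then have "key A = m" using key[of A] by simp
    then have "r ^ m dvd A" using key[of A] by simp
    moreover have "A mod r ^ m = A" using that by (simp add: S_def sym_residues_def)
    ultimately have "A = 0" by (simp add: dvd_eq_mod_eq_0)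
    then show ?thesis using \<open>key A = m\<close> by (simp add: h_def degree_normalize_poly)
  qed
  have card_key: "int (card {A \<in> S. key A = j}) = int (M j) - (if j < m then int (M (Suc j)) else 0)" if "j \<le> m" for j
  proof (cases "j < m")
    case True
    have "key A = j \<longleftrightarrow> r ^ j dvd A \<and> \<not> r ^ Suc j dvd A" for A
    proof -
      have "key A = j \<longleftrightarrow> j \<le> key A \<and> \<not> Suc j \<le> key A" by linarith
      then show ?thesis using key_ge[of j A] key_ge[of "Suc j" A] True by simp
    qed
    then have "{A \<in> S. key A = j} = {A \<in> S. r ^ j dvd A} - {A \<in> S. r ^ Suc j dvd A}"
      by blast
    moreover have sub: "{A \<in> S. r ^ Suc j dvd A} \<subseteq> {A \<in> S. r ^ j dvd A}"
      by (auto dest: dvd_mult_right)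
    ultimately have "int (card {A \<in> S. key A = j}) = int (card {A \<in> S. r ^ j dvd A}) - int (card {A \<in> S. r ^ Suc j dvd A})"
      using card_Diff_subset[OF _ sub] card_mono[OF _ sub] finS by (simp add: of_nat_diff)
    then show ?thesis using M[of j] M[of "Suc j"] True by (simp add: S_def)
  next
    case False
    then have "j = m" using that by simp
    moreover have "{A \<in> S. key A = m} = {A \<in> S. r ^ m dvd A}"
      using key_ge[of m] key by (auto simp: le_antisym)
    ultimately show ?thesis using M[of m] by (simp add: S_def)
  qed
  have "sym_gf n (r ^ m) = (\<Sum>A\<in>S. h A)"
    by (simp add: sym_gf_def S_def h_def)
  also have "\<dots> = (\<Sum>j\<le>m. \<Sum>A\<in>{A \<in> S. key A = j}. h A)"
    by (rule sum.group[symmetric]) (use finS key in auto)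
  also have "\<dots> = (\<Sum>j\<le>m. monom (int (M j) - (if j < m then int (M (Suc j)) else 0)) (d * (m - j)))"
  proof (rule sum.cong[OF refl])
    fix j assume "j \<in> {..m}"
    have "(\<Sum>A\<in>{A \<in> S. key A = j}. h A) = (\<Sum>A\<in>{A \<in> S. key A = j}. monom 1 (d * (m - j)))"
      by (rule sum.cong) (simp_all add: h)
    also have "\<dots> = monom (int (card {A \<in> S. key A = j})) (d * (m - j))"
      by (simp add: of_nat_monom mult_monom)
    finally show "(\<Sum>A\<in>{A \<in> S. key A = j}. h A) =
        monom (int (M j) - (if j < m then int (M (Suc j)) else 0)) (d * (m - j))"
      using card_key[of j] \<open>j \<in> {..m}\<close> by simp
  qed
  also have "\<dots> = (\<Sum>j\<le>m. monom (int (M (m - j)) - (if m - j < m then int (M (Suc (m - j))) else 0)) (d * j))"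
    by (rule sum.reindex_bij_witness[where i = "\<lambda>j. m - j" and j = "\<lambda>j. m - j"]) auto
  also have "{..m} = insert 0 {1..m}" by auto
  also have "(\<Sum>j\<in>insert 0 {1..m}. monom (int (M (m - j)) - (if m - j < m then int (M (Suc (m - j))) else 0)) (d * j)) =
      1 + (\<Sum>j=1..m. monom (int (M (m - j)) - (if m - j < m then int (M (Suc (m - j))) else 0)) (d * j))"
    by (subst sum.insert) (simp_all add: Mm)
  also have "(\<Sum>j=1..m. monom (int (M (m - j)) - (if m - j < m then int (M (Suc (m - j))) else 0)) (d * j)) =
      (\<Sum>j=1..m. monom (int (M (m - j)) - int (M (m - (j - 1)))) (d * j))"
    by (rule sum.cong) (auto simp: Suc_diff_le)
  finally show ?thesis .
qed

section \<open>Powers of prime self-reciprocal polynomials\<close>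

lemma degree_gcd_power:
  fixes r :: "'k::field_gcd poly"
  assumes "r \<noteq> 0" and "coprime B r" and "j \<le> m"
  shows "degree (gcd (r ^ j * B) (r ^ m)) = degree r * j"
proof -
  have "r ^ m = r ^ j * r ^ (m - j)" using assms(3) by (simp flip: power_add)
  then have "gcd (r ^ j * B) (r ^ m) = normalize (r ^ j * gcd B (r ^ (m - j)))"
    by (simp add: gcd_mult_left)
  also have "gcd B (r ^ (m - j)) = 1" using assms(2) by simp
  finally show ?thesis using assms(1) by (simp add: degree_power_eq degree_normalize_poly)
qed

text \<open>Inversion sends the divisor \<open>D\<close> of \<open>A\<close> to the divisor
  \<open>recip n D\<close> of \<open>recip n A\<close>, which is congruent to \<open>A\<close>; and
  up to a power of \<open>x\<close>, a unit modulo \<open>H\<close>, \<open>recip n D\<close> is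
  congruent to the reciprocal of \<open>D\<close>.\<close>

lemma reflect_dvd_sym_residue:
  fixes H :: "'k::field_gcd poly"
  assumes n: "n > 0" and H: "H dvd monom 1 n - 1" and A: "A \<in> sym_residues n H"
    and D: "D dvd A" "D dvd H" "reflect_poly D dvd H"
  shows "reflect_poly D dvd A"
proof -
  have "[monom 1 (degree D) * recip n D = reflect_poly D] (mod (reflect_poly D))"
    using cong_dvd_modulus[OF monom_mult_recip_cong[OF n order.refl, of D] dvd_trans[OF D(3) H]]
    by (simp only: rev_window_degree)
  then have "reflect_poly D dvd monom 1 (degree D) * recip n D"
    by (simp add: cong_def dvd_eq_mod_eq_0)
  then have "reflect_poly D dvd recip n D"
    using coprime_monom_of_dvd[OF n dvd_trans[OF D(3) H], of "degree D"]
    by (simp add: coprime_commute coprime_dvd_mult_right_iff)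
  also have "recip n D dvd recip n A"
    using D(1) by (auto simp: recip_mult elim!: dvdE)
  finally have "reflect_poly D dvd recip n A" .
  moreover have "reflect_poly D dvd recip n A - A"
    using A dvd_trans[OF D(3)] by (simp add: sym_residues_def cong_iff_dvd_diff)
  ultimately have "reflect_poly D dvd recip n A - (recip n A - A)" by (rule dvd_diff)
  then show ?thesis by simp
qed

text \<open>Reflection is multiplicative, so a factorization of the reciprocal yields one of
  \<open>g\<close>. Units can be carried back because the factors have nonzero constant terms and so
  keep their degrees.\<close>

lemma irreducible_reflect_poly:
  fixes g :: "'k::field_gcd poly"
  assumes "irreducible g" "coeff g 0 \<noteq> 0"
  shows "irreducible (reflect_poly g)"
proof (rule irreducibleI)
  show "reflect_poly g \<noteq> 0" using assms(1) by auto
  show "\<not> is_unit (reflect_poly g)"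
    using assms by (auto simp: is_unit_iff_degree irreducible_def)
next
  fix a b assume ab: "reflect_poly g = a * b"
  then have "g = reflect_poly a * reflect_poly b"
    by (metis assms(2) reflect_poly_mult reflect_poly_reflect_poly)
  then have u: "is_unit (reflect_poly a) \<or> is_unit (reflect_poly b)"
    using irreducibleD[OF assms(1)] by blast
  have "coeff (a * b) 0 \<noteq> 0"
    unfolding ab[symmetric] using assms(1) by auto
  then have "coeff a 0 \<noteq> 0" "coeff b 0 \<noteq> 0" by (auto simp: coeff_mult)
  then show "is_unit a \<or> is_unit b"
    using u by (auto simp: is_unit_iff_degree)
qed

lemma irreducible_coprime_or_dvd:
  fixes g :: "'k::field_gcd poly"
  shows "irreducible g \<Longrightarrow> \<not> g dvd B \<Longrightarrow> coprime B g"
  by (metis coprime_commute irreducible_imp_prime_elem_gcd prime_elem_imp_coprime)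

lemma reflect_prime_self_reciprocal:
  assumes "prime_self_reciprocal r"
  shows "reflect_poly r = r"
  using assms by (auto simp: prime_self_reciprocal_def self_reciprocal_def reflect_poly_smult reflect_poly_mult mult.commute)

text \<open>The case \<open>r = u g g'\<close> needs the symmetry of \<open>A\<close>:
  \<open>r ^ j * g\<close> and \<open>r ^ j * g'\<close> are reciprocals of each other and divide
  \<open>r ^ m\<close> because \<open>j < m\<close>, so both or neither divide \<open>A\<close>. If
  \<open>g\<close> divided \<open>B\<close>, so would the coprime product \<open>g g'\<close>, and
  hence \<open>r\<close>.\<close>

lemma coprime_cofactor_prime_self_reciprocal:
  fixes r :: "'k::field_gcd poly"
  assumes n: "n > 0" and H: "r ^ m dvd monom 1 n - 1"
    and r: "prime_self_reciprocal r" and A: "A \<in> sym_residues n (r ^ m)"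
    and j: "j < m" "A = r ^ j * B" "\<not> r dvd B"
  shows "coprime B r"
  using r unfolding prime_self_reciprocal_def
proof (elim conjE disjE exE)
  assume "irreducible r"
  then show ?thesis using j(3) by (rule irreducible_coprime_or_dvd)
next
  fix u g
  assume u: "u \<noteq> 0" and g: "irreducible g" "coeff g 0 \<noteq> 0"
    and ng: "\<forall>c. reflect_poly g \<noteq> smult c g" and rg: "r = smult u (g * reflect_poly g)"
  define g' where "g' = reflect_poly g"
  have r0: "r \<noteq> 0" using u g rg by auto
  have rr: "reflect_poly r = r" by (rule reflect_prime_self_reciprocal[OF r])
  have dvds: "r ^ j * g dvd r ^ m" "r ^ j * g' dvd r ^ m"
  proof -
    have "r ^ Suc j dvd r ^ m" using j(1) by (intro le_imp_power_dvd) simp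
    moreover have "r ^ j * g dvd r ^ Suc j" "r ^ j * g' dvd r ^ Suc j"
      unfolding power_Suc2 by (auto simp: rg g'_def dvd_smult)
    ultimately show "r ^ j * g dvd r ^ m" "r ^ j * g' dvd r ^ m" by (blast intro: dvd_trans)+
  qed
  have refl: "reflect_poly (r ^ j * g) = r ^ j * g'" "reflect_poly (r ^ j * g') = r ^ j * g"
    using g by (simp_all add: reflect_poly_mult reflect_poly_power rr g'_def)
  have "r ^ j * g dvd A \<longleftrightarrow> r ^ j * g' dvd A"
    using reflect_dvd_sym_residue[OF n H A, of "r ^ j * g"] reflect_dvd_sym_residue[OF n H A, of "r ^ j * g'"]
      dvds unfolding refl by blast
  then have iff: "g dvd B \<longleftrightarrow> g' dvd B"
    unfolding j(2) using r0 by simp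
  have irr: "irreducible g'" unfolding g'_def by (rule irreducible_reflect_poly[OF g])
  have cop: "coprime g' g"
  proof (rule irreducible_coprime_or_dvd[OF g(1)])
    \<comment> \<open>As the degrees are equal, divisibility would mean proportionality, which
      \<open>ng\<close> excludes.\<close>
    show "\<not> g dvd g'"
    proof
      assume "g dvd g'"
      then obtain c where c: "g' = g * c" by (elim dvdE)
      have "g \<noteq> 0" "g' \<noteq> 0" using g by (auto simp: g'_def)
      then have "degree g' = degree g + degree c" unfolding c by (subst degree_mult_eq) auto
      moreover have "degree g' = degree g" using g by (simp add: g'_def)
      ultimately have "degree c = 0" by simp
      then obtain d where "c = [:d:]" by (metis degree_eq_zeroE)
      then show False using ng c by (simp add: g'_def)
    qed
  qed
  have "\<not> g dvd B"
  proof
    assume "g dvd B"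
    then have "g * g' dvd B" using iff cop by (simp add: divides_mult coprime_commute)
    then show False using j(3) u by (simp add: rg g'_def smult_dvd_iff)
  qed
  then have "coprime B g" "coprime B g'"
    using irreducible_coprime_or_dvd[OF g(1)] irreducible_coprime_or_dvd[OF irr] iff by blast+
  then have "coprime B (g * g')" by simp
  moreover have "r dvd g * g'" using u by (simp add: rg g'_def smult_dvd_iff)
  ultimately show ?thesis by (meson coprime_divisors dvd_refl)
qed

text \<open>Every power of \<open>r\<close> is palindromic of even degree, so the count of multiples
  applies to each \<open>j\<close> and no rounding occurs.\<close>

lemma sym_gf_prime_self_reciprocal:
  fixes r :: "'k::{field_gcd,finite} poly"
  assumes n: "n > 0" and two: "(2::'k) \<noteq> 0" and H: "r ^ m dvd monom 1 n - 1"
    and r: "prime_self_reciprocal r" "even (degree r)"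
  shows "sym_gf n (r ^ m) = 1 + (\<Sum>j=1..m. monom (int (CARD('k) ^ (degree r * j div 2)) -
    int (CARD('k) ^ (degree r * (j - 1) div 2))) (degree r * j))"
proof -
  have r0: "r \<noteq> 0" using r(1) by (auto simp: prime_self_reciprocal_def)
  have rr: "reflect_poly (r ^ j) = r ^ j" for j
    using reflect_prime_self_reciprocal[OF r(1)] by (simp add: reflect_poly_power)
  have ev: "even (degree (r ^ j))" for j using r(2) r0 by (simp add: degree_power_eq)
  have "sym_gf n (r ^ m) = 1 + (\<Sum>j=1..m. monom (int (CARD('k) ^ (degree r * (m - (m - j)) div 2)) -
    int (CARD('k) ^ (degree r * (m - (m - (j - 1))) div 2))) (degree r * j))"
  proof (rule sym_gf_power[OF r0 refl])
    fix j assume j: "j \<le> m"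
    then have "r ^ j * r ^ (m - j) = r ^ m" by (simp flip: power_add)
    moreover have "(degree (r ^ (m - j)) + 1) div 2 = degree r * (m - j) div 2"
      using ev[of "m - j"] r0 by (simp add: degree_power_eq mult.commute)
    ultimately show "card {A \<in> sym_residues n (r ^ m). r ^ j dvd A} = CARD('k) ^ (degree r * (m - j) div 2)"
      using card_sym_residues_multiples[OF n two, of "r ^ j" "r ^ (m - j)" 1] H rr ev by simp
  next
    fix A j assume A: "A \<in> sym_residues n (r ^ m)" and j: "j < m" and d: "r ^ j dvd A" "\<not> r ^ Suc j dvd A"
    obtain B where B: "A = r ^ j * B" using d(1) by (elim dvdE)
    have "\<not> r dvd B" using d(2) r0 by (simp add: B power_Suc2 del: power_Suc)
    then have "coprime B r"
      by (rule coprime_cofactor_prime_self_reciprocal[OF n H r(1) A j B])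
    then show "degree (gcd A (r ^ m)) = degree r * j"
      unfolding B using degree_gcd_power[OF r0 _ less_imp_le[OF j]] by simp
  qed simp
  also have "\<dots> = 1 + (\<Sum>j=1..m. monom (int (CARD('k) ^ (degree r * j div 2)) -
    int (CARD('k) ^ (degree r * (j - 1) div 2))) (degree r * j))"
    by (intro arg_cong2[where f = "(+)"] sum.cong refl) auto
  finally show ?thesis .
qed

section \<open>The linear factors \<open>x - 1\<close> and \<open>x + 1\<close>\<close>

lemma reflect_linear_poly:
  fixes c :: "'k::field"
  assumes "c * c = 1"
  shows "reflect_poly [:- c, 1:] = smult (- c) [:- c, 1:]"
proof -
  have "c \<noteq> 0" using assms by auto
  then have "reflect_poly [:- c, 1:] = [:1, - c:]" by (simp add: reflect_poly_pCons)
  then show ?thesis using assms by simp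
qed

text \<open>Inversion multiplies \<open>x - c\<close> by \<open>- c/x\<close>, whose value at
  \<open>c\<close> is \<open>- 1\<close>. Cancelling \<open>r ^ j\<close> in the symmetry of
  \<open>r ^ j * B\<close> and evaluating at \<open>c\<close> gives
  \<open>(- 1) ^ j * poly B c = poly B c\<close>. One further factor \<open>r\<close> of the modulus
  must remain, hence \<open>j < m\<close>.\<close>

lemma poly_cofactor_eq_0:
  fixes c :: "'k::field_gcd"
  assumes n: "n > 0" "even n" and two: "(2::'k) \<noteq> 0" and c: "c * c = 1"
    and r: "r = [:- c, 1:]" and H: "r ^ m dvd monom 1 n - 1"
    and A: "r ^ j * B \<in> sym_residues n (r ^ m)" and j: "odd j" "j < m"
  shows "poly B c = 0"
proof -
  \<comment> \<open>This is \<open>- c/x\<close>, with \<open>x ^ (n - 1)\<close> standing for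
    \<open>1/x\<close>; it makes \<open>s\<close> congruent to \<open>recip n r\<close>.\<close>
  define t where "t = smult (- c) (monom 1 (n - 1))"
  define s where "s = r * t"
  have r0: "r \<noteq> 0" by (simp add: r)
  have N: "r ^ Suc j dvd monom 1 n - 1"
    by (rule dvd_trans[OF le_imp_power_dvd H]) (use j in simp)
  have "recip n r = monom 1 (n - 1) - [:c:]"
    by (simp add: recip_def r pcompose_pCons)
  moreover have "s = monom 1 (n - 1) - smult c (monom 1 n)"
  proof -
    have "r = monom 1 1 - [:c:]" by (simp add: r monom_Suc)
    then show ?thesis
      using n c by (simp add: s_def t_def left_diff_distrib mult_monom smult_diff_right smult_monom flip: monom_0 minus_monom)
  qed
  ultimately have "recip n r - s = smult c (monom 1 n - 1)"
    by (simp add: smult_diff_right)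
  then have "[recip n r = s] (mod monom 1 n - 1)"
    by (simp add: cong_iff_dvd_diff dvd_smult)
  then have "[recip n r ^ j * recip n B = s ^ j * recip n B] (mod r ^ Suc j)"
    by (intro cong_mult cong_pow cong_refl cong_dvd_modulus[OF _ N])
  moreover have "[recip n r ^ j * recip n B = r ^ j * B] (mod r ^ Suc j)"
  proof -
    have "[recip n (r ^ j * B) = r ^ j * B] (mod r ^ m)" using A by (simp add: sym_residues_def)
    then show ?thesis
      unfolding recip_mult recip_power
      by (rule cong_dvd_modulus) (intro le_imp_power_dvd, use j in simp)
  qed
  ultimately have "[s ^ j * recip n B = r ^ j * B] (mod r ^ Suc j)"
    by (metis cong_sym cong_trans)
  moreover have "s ^ j * recip n B - r ^ j * B = r ^ j * (t ^ j * recip n B - B)"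
    by (simp add: s_def power_mult_distrib algebra_simps)
  ultimately have "r dvd t ^ j * recip n B - B"
    using r0 by (simp add: cong_iff_dvd_diff power_Suc2 del: power_Suc)
  then have "poly (t ^ j * recip n B - B) c = 0"
    unfolding r poly_eq_0_iff_dvd .
  \<comment> \<open>Evenness of \<open>n\<close> keeps \<open>c = - 1\<close> fixed under the
    exponent \<open>n - 1\<close>, which also gives
    \<open>poly (recip n B) c = poly B c\<close>.\<close>
  moreover have cn: "c ^ (n - 1) = c"
  proof -
    have "odd (n - 1)" using n by simp
    then obtain i where "n - 1 = 2 * i + 1" by (elim oddE)
    then show ?thesis using c by (simp add: power_mult power2_eq_square)
  qed
  ultimately have "(- (c * c)) ^ j * poly B c - poly B c = 0"
    by (simp add: t_def recip_def poly_pcompose poly_monom poly_power)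
  then have "- 2 * poly B c = 0"
    using c j by (simp add: algebra_simps)
  then show ?thesis using two by simp
qed

text \<open>For even \<open>j\<close> the two exponents agree and the term vanishes;
  \<open>j = 2 * i - 1\<close> contributes \<open>Q ^ i - Q ^ (i - 1)\<close>.\<close>

lemma sum_odd_terms:
  fixes Q :: int
  assumes "odd m"
  shows "(\<Sum>j=1..m. monom (Q ^ ((j + 1) div 2) - Q ^ (j div 2)) j) =
         (\<Sum>j=1..(m + 1) div 2. monom (Q ^ (j - 1) * (Q - 1)) (2 * j - 1))"
proof -
  have inj: "inj_on (\<lambda>j::nat. 2 * j - 1) {1..(m + 1) div 2}"
    by (rule inj_onI) auto
  have "(\<Sum>j=1..m. monom (Q ^ ((j + 1) div 2) - Q ^ (j div 2)) j) =
      (\<Sum>j\<in>(\<lambda>j. 2 * j - 1) ` {1..(m + 1) div 2}. monom (Q ^ ((j + 1) div 2) - Q ^ (j div 2)) j)"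
  proof (rule sum.mono_neutral_right)
    show "(\<lambda>j. 2 * j - 1) ` {1..(m + 1) div 2} \<subseteq> {1..m}"
    proof -
      obtain i where "m = 2 * i + 1" using assms by (elim oddE)
      then show ?thesis by auto
    qed
    show "\<forall>j\<in>{1..m} - (\<lambda>j. 2 * j - 1) ` {1..(m + 1) div 2}. monom (Q ^ ((j + 1) div 2) - Q ^ (j div 2)) j = 0"
    proof
      fix j assume j: "j \<in> {1..m} - (\<lambda>j. 2 * j - 1) ` {1..(m + 1) div 2}"
      have "even j"
      proof (rule ccontr)
        assume "odd j"
        then obtain i where "j = 2 * i + 1" by (elim oddE)
        then have "j = 2 * (i + 1) - 1" "i + 1 \<in> {1..(m + 1) div 2}" using j by auto
        then show False using j by blast
      qed
      then show "monom (Q ^ ((j + 1) div 2) - Q ^ (j div 2)) j = 0" by simp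
    qed
  qed simp
  also have "\<dots> = (\<Sum>j=1..(m + 1) div 2. monom (Q ^ ((2 * j - 1 + 1) div 2) - Q ^ ((2 * j - 1) div 2)) (2 * j - 1))"
    by (subst sum.reindex[OF inj]) (simp only: o_def)
  also have "\<dots> = (\<Sum>j=1..(m + 1) div 2. monom (Q ^ (j - 1) * (Q - 1)) (2 * j - 1))"
  proof (rule sum.cong[OF refl])
    fix j assume "j \<in> {1..(m + 1) div 2}"
    then obtain i where "j = Suc i" by (cases j) auto
    then show "monom (Q ^ ((2 * j - 1 + 1) div 2) - Q ^ ((2 * j - 1) div 2)) (2 * j - 1) =
        monom (Q ^ (j - 1) * (Q - 1)) (2 * j - 1)"
      by (simp add: algebra_simps)
  qed
  finally show ?thesis .
qed

text \<open>Even powers of \<open>r\<close> are palindromic of even degree, so for even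
  \<open>j\<close> the multiples can be counted directly; the cofactor \<open>r ^ (m - j)\<close>
  then has odd degree and may carry a sign. For odd \<open>j < m\<close>, the vanishing of the
  cofactor at \<open>c\<close> identifies the multiples of \<open>r ^ j\<close> with those of
  \<open>r ^ Suc j\<close>.\<close>

lemma sym_gf_linear:
  fixes r :: "'k::{field_gcd,finite} poly"
  assumes n: "n > 0" "even n" and two: "(2::'k) \<noteq> 0" and c: "c * c = 1"
    and r: "r = [:- c, 1:]" and H: "r ^ m dvd monom 1 n - 1" and m: "odd m"
  shows "sym_gf n (r ^ m) = 1 + (\<Sum>j=1..(m + 1) div 2. monom (int CARD('k) ^ (j - 1) * (int CARD('k) - 1)) (2 * j - 1))"
proof -
  have r0: "r \<noteq> 0" and deg: "degree r = 1" by (simp_all add: r)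
  have rr: "reflect_poly (r ^ j) = smult ((- c) ^ j) (r ^ j)" for j
    by (simp only: r reflect_poly_power reflect_linear_poly[OF c] smult_power)
  have degr: "degree (r ^ j) = j" for j using r0 deg by (simp add: degree_power_eq)
  have Hj: "r ^ j * r ^ (m - j) dvd monom 1 n - 1" if "j \<le> m" for j
    using H that by (simp flip: power_add)
  have card_even: "card {A \<in> sym_residues n (r ^ m). r ^ j dvd A} = CARD('k) ^ ((m - j + 1) div 2)"
    if "j \<le> m" "even j" for j
  proof -
    have "r ^ j * r ^ (m - j) = r ^ m" using that by (simp flip: power_add)
    moreover have "(- c) ^ j = 1" using that(2) c by (auto simp: power_mult power2_eq_square elim!: evenE)
    then have "reflect_poly (r ^ j) = r ^ j" using rr[of j] by simp
    moreover have "even (degree (r ^ j))" "odd (degree (r ^ (m - j)))"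
      using that m by (simp_all add: degr)
    ultimately show ?thesis
      using card_sym_residues_multiples[OF n(1) two Hj[OF that(1)] _ _ rr] by (simp add: degr)
  qed
  have card_j: "card {A \<in> sym_residues n (r ^ m). r ^ j dvd A} = CARD('k) ^ ((m - j + 1) div 2)"
    if j: "j \<le> m" for j
  proof -
    consider "even j" | "odd j" "j < m" | "j = m" using j by linarith
    then show ?thesis
    proof cases
      case 1
      then show ?thesis using card_even j by blast
    next
      case 2
      have "r ^ j dvd A \<longleftrightarrow> r ^ Suc j dvd A" if A: "A \<in> sym_residues n (r ^ m)" for A
      proof
        assume "r ^ j dvd A"
        then obtain B where B: "A = r ^ j * B" by (elim dvdE)
        have "poly B c = 0"
          by (rule poly_cofactor_eq_0[OF n two c r H _ 2]) (use A B in simp)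
        then have "r dvd B" by (simp add: r poly_eq_0_iff_dvd)
        then show "r ^ Suc j dvd A" by (simp add: B power_Suc2 mult_dvd_mono del: power_Suc)
      next
        assume "r ^ Suc j dvd A"
        then show "r ^ j dvd A" by (auto dest: dvd_mult_right)
      qed
      then have "{A \<in> sym_residues n (r ^ m). r ^ j dvd A} = {A \<in> sym_residues n (r ^ m). r ^ Suc j dvd A}"
        by blast
      \<comment> \<open>Here \<open>m - j\<close> is even, so passing to \<open>Suc j\<close> leaves
        the rounded half unchanged.\<close>
      moreover have "(m - Suc j + 1) div 2 = (m - j + 1) div 2" using 2 m by presburger
      ultimately show ?thesis using card_even[of "Suc j"] 2 by simp
    next
      case 3
      have "r ^ m dvd recip n (r ^ m)" by (rule dvd_recip_self[OF n(1) H rr])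
      then have "0 \<in> sym_residues n (r ^ m)" by (rule sym_residues_0)
      then have "{A \<in> sym_residues n (r ^ m). r ^ m dvd A} = {0}"
        by (auto simp: sym_residues_def dvd_eq_mod_eq_0)
      then show ?thesis using 3 by simp
    qed
  qed
  have "sym_gf n (r ^ m) = 1 + (\<Sum>j=1..m. monom (int (CARD('k) ^ ((m - (m - j) + 1) div 2)) -
    int (CARD('k) ^ ((m - (m - (j - 1)) + 1) div 2))) (1 * j))"
  proof (rule sym_gf_power[OF r0 deg card_j])
    fix A j assume A: "A \<in> sym_residues n (r ^ m)" and j: "j < m" and d: "r ^ j dvd A" "\<not> r ^ Suc j dvd A"
    obtain B where B: "A = r ^ j * B" using d(1) by (elim dvdE)
    have "\<not> r dvd B" using d(2) r0 by (simp add: B power_Suc2 del: power_Suc)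
    moreover have "irreducible r" unfolding r by (rule irreducible_linear_field_poly) simp
    ultimately have "coprime B r" by (intro irreducible_coprime_or_dvd)
    then show "degree (gcd A (r ^ m)) = 1 * j"
      unfolding B using degree_gcd_power[OF r0 _ less_imp_le[OF j]] deg by simp
  qed simp_all
  also have "\<dots> = 1 + (\<Sum>j=1..m. monom (int CARD('k) ^ ((j + 1) div 2) - int CARD('k) ^ (j div 2)) j)"
    by (intro arg_cong2[where f = "(+)"] sum.cong refl) auto
  finally show ?thesis unfolding sum_odd_terms[OF m] .
qed

section \<open>Splitting along the factorization of \<open>x ^ n - 1\<close>\<close>

text \<open>A common factor \<open>f\<close> would divide \<open>x ^ m - 1\<close> twice, hence also
  the derivative \<open>m x ^ (m - 1)\<close>; but \<open>m\<close> is invertible and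
  \<open>x\<close> is coprime to \<open>f\<close>.\<close>

lemma coprime_if_mult_dvd_monom_minus_1:
  fixes a b :: "'k::field_gcd poly"
  assumes m: "(of_nat m :: 'k) \<noteq> 0" and ab: "a * b dvd monom 1 m - 1"
  shows "coprime a b"
proof (rule coprimeI)
  fix f assume "f dvd a" "f dvd b"
  then have "f * f dvd monom 1 m - 1" using ab by (meson mult_dvd_mono dvd_trans)
  then obtain h where h: "monom 1 m - 1 = f * f * h" by (elim dvdE)
  have "monom (of_nat m) (m - 1) = pderiv (f * f * h)"
    unfolding h[symmetric] by (simp add: pderiv_diff pderiv_monom)
  also have "\<dots> = f * (pderiv f * h + pderiv f * h + f * pderiv h)"
    by (simp add: pderiv_mult algebra_simps)
  finally have "f dvd smult (of_nat m) (monom 1 (m - 1))" by (simp add: smult_monom)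
  then have "f dvd monom 1 (m - 1)" using m by (simp add: dvd_smult_iff)
  moreover have "m > 0" using m by (intro gr0I) auto
  then have "coprime (monom 1 (m - 1)) f"
    by (rule coprime_monom_of_dvd) (simp add: h)
  ultimately show "is_unit f" by (simp add: coprime_absorb_right)
qed

lemma two_neq_0_mod_ring:
  assumes "odd CARD('p::prime_card)"
  shows "(2 :: 'p mod_ring) \<noteq> 0"
proof
  assume "(2 :: 'p mod_ring) = 0"
  then have "CARD('p) dvd 2" using of_nat_0_mod_ring_dvd[of 2, where 'a = 'p] by simp
  then have "CARD('p) = 2"
    using prime_card[where 'a = 'p] two_is_prime_nat primes_dvd_imp_eq by blast
  then show False using assms by simp
qed

text \<open>With \<open>n = q m\<close> and \<open>m\<close> prime to \<open>p\<close>, both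
  \<open>x ^ m - 1\<close> and the product of the distinct factors have \<open>x ^ n - 1\<close> as
  their \<open>q\<close>-th power. That power map is additive, hence injective, so the two are
  equal. As \<open>x ^ m - 1\<close> is separable, the factors are pairwise coprime and the
  generating function splits.\<close>

lemma sym_gf_monom_minus_1:
  fixes r :: "nat \<Rightarrow> 'p::prime_card mod_ring poly"
  assumes p: "CARD('p) = p" "odd p" and n: "n > 0" "even n" and v: "v = multiplicity p n"
    and fac: "monom 1 n - 1 = [:-1, 1:] ^ (p ^ v) * [:1, 1:] ^ (p ^ v) * (\<Prod>i=1..k. r i ^ (p ^ v))"
    and r: "\<And>i. i \<in> {1..k} \<Longrightarrow> prime_self_reciprocal (r i)" "\<And>i. i \<in> {1..k} \<Longrightarrow> even (degree (r i))"
  shows "sym_gf n (monom 1 n - 1 :: 'p mod_ring poly) =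
    (1 + (\<Sum>j=1..(p ^ v + 1) div 2. monom (int p ^ (j - 1) * (int p - 1)) (2 * j - 1))) ^ 2 *
           (\<Prod>i=1..k. 1 +
              (\<Sum>j=1..p ^ v.
                 monom (int p ^ (degree (r i ^ j) div 2)
                          - int p ^ ((degree (r i ^ j) - degree (r i)) div 2))
                       (j * degree (r i))))"
proof -
  define q where "q = p ^ v"
  define l0 l1 :: "'p mod_ring poly" where "l0 = [:-1, 1:]" and "l1 = [:1, 1:]"
  define P where "P = (\<Prod>i=1..k. r i)"
  have prime: "prime p" using prime_card[where 'a = 'p] p(1) by simp
  have q: "odd q" unfolding q_def using p(2) by simp
  have two: "(2 :: 'p mod_ring) \<noteq> 0"
    by (rule two_neq_0_mod_ring) (use p in simp)
  obtain m where m: "n = q * m" "\<not> p dvd m"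
    using multiplicity_decompose'[of n p] n(1) prime unfolding q_def v
    by (metis not_prime_unit neq0_conv)
  have m0: "(of_nat m :: 'p mod_ring) \<noteq> 0" using of_nat_0_mod_ring_dvd[of m, where 'a = 'p] m p(1) by auto
  have N: "monom 1 n - 1 = (l0 * l1 * P) ^ q"
    unfolding fac l0_def l1_def P_def q_def power_mult_distrib prod_power_distrib ..
  have frob: "(a + b) ^ q = a ^ q + b ^ q" for a b :: "'p mod_ring poly"
    by (rule freshmans_dream'[of _ v]) (use prime p in \<open>simp_all add: q_def\<close>)
  have frob_diff: "(a - b) ^ q = a ^ q - b ^ q" for a b :: "'p mod_ring poly"
    using frob[of "a - b" b] by simp
  have "(l0 * l1 * P) ^ q = (monom 1 m - 1) ^ q"
    unfolding N[symmetric] frob_diff by (simp add: monom_power m(1) mult.commute)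
  then have "(l0 * l1 * P - (monom 1 m - 1)) ^ q = 0" unfolding frob_diff by simp
  then have rad: "l0 * l1 * P = monom 1 m - 1" by simp
  have cop: "coprime a b" if "a * b dvd l0 * l1 * P" for a b
    by (rule coprime_if_mult_dvd_monom_minus_1[OF m0]) (use that rad in simp)
  have coprs: "coprime l0 l1" "coprime (l0 * l1) P" by (rule cop; simp add: mult.assoc)+
  have copr: "coprime (r i) (r j)" if "i \<in> {1..k}" "j \<in> {1..k}" "i \<noteq> j" for i j
  proof (rule cop)
    have "P = r i * (r j * (\<Prod>i\<in>{1..k} - {i} - {j}. r i))"
      unfolding P_def using that by (subst prod.remove[of _ i], simp_all) (subst prod.remove[of _ j], simp_all)
    then have "r i * r j dvd P" by (metis dvd_triv_left mult.assoc)
    then show "r i * r j dvd l0 * l1 * P" by (rule dvd_mult)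
  qed
  have N': "monom 1 n - 1 = l0 ^ q * l1 ^ q * (\<Prod>i=1..k. r i ^ q)"
    using fac by (simp add: l0_def l1_def q_def)
  have dv: "l0 ^ q dvd monom 1 n - 1" "l1 ^ q dvd monom 1 n - 1"
    unfolding N' by simp_all
  have dvr: "r i ^ q dvd monom 1 n - 1" if "i \<in> {1..k}" for i
    unfolding N' using that by (intro dvd_mult dvd_prodI) auto
  have rec0: "l0 ^ q dvd recip n (l0 ^ q)"
    by (rule dvd_recip_self[OF n(1) dv(1), of "(- 1) ^ q"])
      (simp only: l0_def reflect_poly_power reflect_linear_poly[of "1 :: 'p mod_ring", OF mult_1] smult_power)
  have rec1: "l1 ^ q dvd recip n (l1 ^ q)"
    by (rule dvd_recip_self[OF n(1) dv(2), of 1])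
      (use reflect_linear_poly[of "- 1 :: 'p mod_ring"] in \<open>simp add: l1_def reflect_poly_power\<close>)
  have recr: "r i ^ q dvd recip n (r i ^ q)" if "i \<in> {1..k}" for i
    by (rule dvd_recip_self[OF n(1) dvr[OF that], of 1])
      (simp add: reflect_poly_power reflect_prime_self_reciprocal[OF r(1)[OF that]])
  have nz: "monom 1 n - 1 \<noteq> (0 :: 'p mod_ring poly)" by (rule monom_minus_1_nonzero[OF n(1)])
  then have nzs: "l0 ^ q \<noteq> 0" "l1 ^ q \<noteq> 0" "(\<Prod>i=1..k. r i ^ q) \<noteq> 0" unfolding N' mult_eq_0_iff by blast+
  have recP: "(\<Prod>i=1..k. r i ^ q) dvd recip n (\<Prod>i=1..k. r i ^ q)"
  proof -
    have "recip n (\<Prod>i=1..k. r i ^ q) = (\<Prod>i=1..k. recip n (r i ^ q))"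
      by (simp add: recip_def pcompose_prod)
    moreover have "(\<Prod>i=1..k. r i ^ q) dvd (\<Prod>i=1..k. recip n (r i ^ q))"
      by (rule prod_dvd_prod) (rule recr)
    ultimately show ?thesis by simp
  qed
  have "sym_gf n (monom 1 n - 1 :: 'p mod_ring poly) = sym_gf n (l0 ^ q * l1 ^ q) * sym_gf n (\<Prod>i=1..k. r i ^ q)"
    unfolding N'
  proof (rule sym_gf_mult)
    show "coprime (l0 ^ q * l1 ^ q) (\<Prod>i=1..k. r i ^ q)"
      using coprs(2) by (simp add: P_def prod_power_distrib[symmetric])
    show "l0 ^ q * l1 ^ q dvd recip n (l0 ^ q * l1 ^ q)"
      unfolding recip_mult by (intro mult_dvd_mono rec0 rec1)
  qed (use nzs recP in auto)
  also have "sym_gf n (l0 ^ q * l1 ^ q) = sym_gf n (l0 ^ q) * sym_gf n (l1 ^ q)"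
    by (rule sym_gf_mult) (use coprs nzs rec0 rec1 in auto)
  also have "sym_gf n (\<Prod>i=1..k. r i ^ q) = (\<Prod>i=1..k. sym_gf n (r i ^ q))"
  proof (rule sym_gf_prod)
    show "r i ^ q \<noteq> 0" if "i \<in> {1..k}" for i using dvr[OF that] nz by (metis dvd_0_left)
  qed (use copr recr in auto)
  also have "sym_gf n (l0 ^ q) = 1 + (\<Sum>j=1..(q + 1) div 2. monom (int p ^ (j - 1) * (int p - 1)) (2 * j - 1))"
    using sym_gf_linear[OF n two _ _ dv(1) q, of 1] p(1) by (simp add: l0_def)
  also have "sym_gf n (l1 ^ q) = 1 + (\<Sum>j=1..(q + 1) div 2. monom (int p ^ (j - 1) * (int p - 1)) (2 * j - 1))"
    using sym_gf_linear[OF n two _ _ dv(2) q, of "- 1"] p(1) by (simp add: l1_def)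
  also have "(\<Prod>i=1..k. sym_gf n (r i ^ q)) = (\<Prod>i=1..k. 1 + (\<Sum>j=1..q.
      monom (int p ^ (degree (r i ^ j) div 2) - int p ^ ((degree (r i ^ j) - degree (r i)) div 2)) (j * degree (r i))))"
  proof (rule prod.cong[OF refl])
    fix i assume i: "i \<in> {1..k}"
    have "r i \<noteq> 0" using r(1)[OF i] by (auto simp: prime_self_reciprocal_def)
    then have deg: "degree (r i ^ j) = degree (r i) * j" for j by (simp add: degree_power_eq)
    have "degree (r i) * j - degree (r i) = degree (r i) * (j - 1)" for j
      by (simp add: diff_mult_distrib2)
    then show "sym_gf n (r i ^ q) = 1 + (\<Sum>j=1..q.
      monom (int p ^ (degree (r i ^ j) div 2) - int p ^ ((degree (r i ^ j) - degree (r i)) div 2)) (j * degree (r i)))"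
      unfolding deg using sym_gf_prime_self_reciprocal[OF n(1) two dvr[OF i] r(1)[OF i] r(2)[OF i]] p(1)
      by (simp add: mult.commute)
  qed
  finally show ?thesis by (simp add: q_def power2_eq_square)
qed

section \<open>Characters and the trace\<close>

text \<open>Translation by some \<open>k\<close> with \<open>\<chi> k \<noteq> 1\<close> permutes
  \<open>K\<close> and multiplies the sum by \<open>\<chi> k\<close>, so the sum is zero.\<close>

lemma sum_character_subgroup:
  fixes \<chi> :: "'a::ab_group_add \<Rightarrow> complex"
  assumes "finite K" and add: "\<And>x y. x \<in> K \<Longrightarrow> y \<in> K \<Longrightarrow> x + y \<in> K" "\<And>x y. x \<in> K \<Longrightarrow> y \<in> K \<Longrightarrow> x - y \<in> K"
    and hom: "\<And>x y. x \<in> K \<Longrightarrow> y \<in> K \<Longrightarrow> \<chi> (x + y) = \<chi> x * \<chi> y"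
  shows "sum \<chi> K = (if \<forall>k\<in>K. \<chi> k = 1 then of_nat (card K) else 0)"
proof (cases "\<forall>k\<in>K. \<chi> k = 1")
  case False
  then obtain k where k: "k \<in> K" "\<chi> k \<noteq> 1" by blast
  have "sum \<chi> K = (\<Sum>x\<in>K. \<chi> (k + x))"
    by (rule sum.reindex_bij_witness[of _ "\<lambda>x. k + x" "\<lambda>x. x - k"]) (use add k in auto)
  also have "\<dots> = \<chi> k * sum \<chi> K"
    unfolding sum_distrib_left by (rule sum.cong) (use hom k in auto)
  finally have "(\<chi> k - 1) * sum \<chi> K = 0" by (simp add: algebra_simps)
  then show ?thesis using k False by auto
qed simp

definition zeta :: "nat \<Rightarrow> complex" where
  "zeta p = exp (2 * of_real pi * \<i> / of_nat p)"

lemma zeta_power_self: "p > 0 \<Longrightarrow> zeta p ^ p = 1"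
  by (simp add: zeta_def exp_of_nat_mult[symmetric])

text \<open>Integer representatives add only modulo \<open>p\<close>; \<open>zeta p ^ p = 1\<close>
  absorbs the difference.\<close>

lemma eps_pow_add:
  fixes a b :: "'p::prime_card mod_ring"
  shows "eps_pow (a + b) = eps_pow a * eps_pow b"
proof -
  define w where "w = zeta CARD('p)"
  have w: "w \<noteq> 0" "w powi int CARD('p) = 1"
    using zeta_power_self[of "CARD('p)"] by (auto simp: w_def zeta_def)
  have mod: "w powi (k mod int CARD('p)) = w powi k" for k
  proof -
    have "w powi k = w powi (int CARD('p) * (k div int CARD('p)) + k mod int CARD('p))" by simp
    also have "\<dots> = w powi (k mod int CARD('p))"
      unfolding power_int_add[OF disjI1[OF w(1)]] power_int_mult w(2) by simp
    finally show ?thesis ..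
  qed
  have "eps_pow c = w powi to_int_mod_ring c" for c :: "'p mod_ring"
    by (simp add: eps_pow_def w_def zeta_def)
  then show ?thesis
    using w by (simp add: to_int_mod_ring_add mod power_int_add)
qed

lemma eps_pow_0 [simp]: "eps_pow (0 :: 'p::prime_card mod_ring) = 1"
  by (simp add: eps_pow_def)

lemma cmod_eps_pow [simp]: "cmod (eps_pow (c :: 'p::prime_card mod_ring)) = 1"
  by (simp add: eps_pow_def norm_power_int)

lemma cnj_eps_pow: "cnj (eps_pow c) = eps_pow (- c :: 'p::prime_card mod_ring)"
proof -
  have "eps_pow c * eps_pow (- c) = 1"
    by (simp flip: eps_pow_add)
  moreover have "eps_pow c * cnj (eps_pow c) = 1"
    by (simp add: complex_mult_cnj cmod_power2[symmetric])
  moreover have "eps_pow c \<noteq> 0" by (metis cmod_eps_pow norm_zero zero_neq_one)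
  ultimately show ?thesis by (metis mult_cancel_left)
qed

lemma eps_pow_1_neq_1:
  assumes "odd CARD('p::prime_card)"
  shows "eps_pow (1 :: 'p mod_ring) \<noteq> 1"
proof -
  define t where "t = 2 * pi / real CARD('p)"
  have "CARD('p) \<noteq> 1" "CARD('p) \<noteq> 2" using prime_card[where 'a = 'p] assms by auto
  then have "CARD('p) \<ge> 3" using zero_less_card_finite[where 'a = 'p] by linarith
  then have "0 < t" "t < pi" by (auto simp: t_def field_simps)
  then have "sin t > 0" by (rule sin_gt_zero)
  moreover have "eps_pow (1 :: 'p mod_ring) = cis t"
    by (simp add: eps_pow_def cis_conv_exp t_def mult_ac)
  ultimately show ?thesis
    by (metis cis.sel(2) less_irrefl one_complex.sel(2))
qed

section \<open>The trace onto the prime field\<close>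

locale prime_field_extension =
  fixes n :: nat and A :: "'a::{field,finite} itself" and P :: "'p::prime_card itself"
  assumes card_ext: "CARD('a) = CARD('p) ^ n" and n_pos: "n > 0" and odd_p: "odd CARD('p)"
begin

abbreviation incl :: "'p mod_ring \<Rightarrow> 'a" where "incl \<equiv> Fp_incl"

abbreviation tr :: "'a \<Rightarrow> 'p mod_ring" where "tr \<equiv> abs_trace n"

lemma prime_p: "prime CARD('p)"
  by (rule prime_card)

lemma CHAR_ext: "CHAR('a) = CARD('p)"
proof -
  have "CHAR('a) dvd CARD('p) ^ n" using CHAR_dvd_CARD[where 'a = 'a] card_ext by simp
  moreover have "prime CHAR('a)"
    using prime_CHAR_semidom[where 'a = 'a] finite_imp_CHAR_pos[where 'a = 'a] by simp
  ultimately show ?thesis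
    using prime_p by (meson prime_dvd_power primes_dvd_imp_eq)
qed

lemma incl_0 [simp]: "incl 0 = 0"
  by (simp add: Fp_incl_def)

lemma incl_1 [simp]: "incl 1 = 1"
  by (simp add: Fp_incl_def)

lemma incl_add: "incl (a + b) = incl a + incl b"
proof -
  have "incl (a + b) = of_int ((to_int_mod_ring a + to_int_mod_ring b) mod int CHAR('a))"
    by (simp only: Fp_incl_def to_int_mod_ring_add CHAR_ext)
  then show ?thesis by (simp only: of_int_mod_CHAR of_int_add Fp_incl_def)
qed

lemma incl_mult: "incl (a * b) = incl a * incl b"
proof -
  have "incl (a * b) = of_int ((to_int_mod_ring a * to_int_mod_ring b) mod int CHAR('a))"
    by (simp only: Fp_incl_def to_int_mod_ring_mult CHAR_ext)
  then show ?thesis by (simp only: of_int_mod_CHAR of_int_mult Fp_incl_def)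
qed

lemma incl_eq_0_iff: "incl a = 0 \<longleftrightarrow> a = 0"
proof
  assume "incl a = 0"
  show "a = 0"
  proof (rule ccontr)
    assume "a \<noteq> 0"
    then have "incl a * incl (inverse a) = 1" by (simp flip: incl_mult)
    then show False using \<open>incl a = 0\<close> by simp
  qed
qed simp

lemma incl_minus: "incl (- a) = - incl a"
  by (metis add.right_inverse add_eq_0_iff incl_0 incl_add)

lemma inj_incl: "inj incl"
proof (rule injI)
  fix a b assume "incl a = incl b"
  then have "incl (a - b) = 0" by (simp only: diff_conv_add_uminus incl_add incl_minus) simp
  then show "a = b" by (simp add: incl_eq_0_iff)
qed

lemma incl_power: "incl (a ^ k) = incl a ^ k"
  by (induction k) (simp_all add: incl_mult)

lemma incl_power_p: "incl a ^ (CARD('p) ^ i) = incl a"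
  using finite_field_power_card_power_eq_same[of "CARD('p) ^ i" i a] by (simp flip: incl_power)

lemma frobenius_add: "(x + y :: 'a) ^ (CARD('p) ^ i) = x ^ (CARD('p) ^ i) + y ^ (CARD('p) ^ i)"
  by (rule freshmans_dream'[of _ i]) (simp_all add: CHAR_ext prime_p)

lemma frobenius_sum: "(\<Sum>j\<in>J. f j :: 'a) ^ (CARD('p) ^ i) = (\<Sum>j\<in>J. f j ^ (CARD('p) ^ i))"
  by (rule freshmans_dream_sum'[of _ i]) (simp_all add: CHAR_ext prime_p)

text \<open>Multiplication by a nonzero \<open>x\<close> permutes the nonzero elements; comparing
  their products gives the exponent.\<close>

lemma power_card_ext: "(x :: 'a) ^ (CARD('p) ^ n) = x"
proof (cases "x = 0")
  case False
  have "(\<Prod>y\<in>UNIV-{0}. x * y) = (\<Prod>y\<in>UNIV-{0}. y)"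
    by (rule prod.reindex_bij_witness[of _ "\<lambda>y. y / x" "\<lambda>y. x * y"]) (use False in auto)
  then have "x ^ (CARD('a) - 1) = 1"
    by (simp add: prod.distrib)
  moreover have "CARD('p) ^ n = Suc (CARD('a) - 1)" using card_ext by simp
  ultimately show ?thesis by (simp only: power_Suc mult_1_right)
qed simp

text \<open>\<open>x ^ p - x\<close> has at most \<open>p\<close> roots, and the prime field already
  provides \<open>p\<close> of them.\<close>

lemma fixed_by_frobenius:
  assumes "(y :: 'a) ^ CARD('p) = y"
  shows "y \<in> range incl"
proof -
  define f :: "'a poly" where "f = monom 1 CARD('p) - monom 1 1"
  have p1: "CARD('p) > 1" using prime_p prime_gt_1_nat by blast
  have coeff: "coeff f CARD('p) = 1" using p1 by (simp add: f_def)
  then have f0: "f \<noteq> 0" by auto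
  have "degree f \<le> CARD('p)"
    unfolding f_def using p1 by (intro degree_diff_le degree_monom_le order.trans[OF degree_monom_le]) auto
  have roots: "{y. poly f y = 0} = {y. y ^ CARD('p) = y}" by (simp add: f_def poly_monom)
  have "card {y :: 'a. y ^ CARD('p) = y} \<le> CARD('p)"
    using card_poly_roots_bound[OF f0] \<open>degree f \<le> CARD('p)\<close> roots by simp
  moreover have "range incl \<subseteq> {y. y ^ CARD('p) = y}" using incl_power_p[of _ 1] by auto
  moreover have "card (range incl) = CARD('p)" using card_image[OF inj_incl] by simp
  ultimately have "range incl = {y. y ^ CARD('p) = y}"
    by (intro card_seteq) auto
  then show ?thesis using assms by simp
qed

text \<open>The \<open>p\<close>-th power permutes the conjugates cyclically, as
  \<open>x ^ (p ^ n) = x\<close>, so their sum lies in the prime field. With injectivity of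
  \<open>incl\<close>, the description in \<open>abs_trace\<close> has exactly one solution.\<close>

lemma incl_tr: "incl (tr x) = (\<Sum>i<n. x ^ (CARD('p) ^ i))"
proof -
  have "(\<Sum>i<n. x ^ (CARD('p) ^ i)) ^ CARD('p) = (\<Sum>i<n. x ^ (CARD('p) ^ Suc i))"
    using frobenius_sum[of "\<lambda>i. x ^ (CARD('p) ^ i)" "{..<n}" 1] by (simp add: power_mult[symmetric] mult.commute)
  also have "\<dots> = (\<Sum>i<n. x ^ (CARD('p) ^ i)) + x ^ (CARD('p) ^ n) - x ^ (CARD('p) ^ 0)"
    using sum.lessThan_Suc_shift[of "\<lambda>i. x ^ (CARD('p) ^ i)" n] by (simp add: algebra_simps)
  finally have "(\<Sum>i<n. x ^ (CARD('p) ^ i)) ^ CARD('p) = (\<Sum>i<n. x ^ (CARD('p) ^ i))"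
    by (simp add: power_card_ext)
  then obtain c where c: "incl c = (\<Sum>i<n. x ^ (CARD('p) ^ i))"
    using fixed_by_frobenius by (metis rangeE)
  show ?thesis
    unfolding abs_trace_def
  proof (rule theI)
    show "incl c = (\<Sum>i<n. x ^ (CARD('p) ^ i))" by (rule c)
    show "c' = c" if "incl c' = (\<Sum>i<n. x ^ (CARD('p) ^ i))" for c'
      using that c injD[OF inj_incl] by metis
  qed
qed

lemma tr_add: "tr (x + y) = tr x + tr y"
  by (rule injD[OF inj_incl]) (simp add: incl_tr incl_add frobenius_add sum.distrib)

lemma tr_0 [simp]: "tr 0 = 0"
  using tr_add[of 0 0] by (metis add_0_left add_right_cancel)

lemma tr_sum: "tr (\<Sum>j\<in>J. f j) = (\<Sum>j\<in>J. tr (f j))"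
  by (induction J rule: infinite_finite_induct) (simp_all add: tr_add)

lemma tr_scale: "tr (incl c * x) = c * tr x"
  by (rule injD[OF inj_incl])
    (simp add: incl_tr incl_mult power_mult_distrib incl_power_p sum_distrib_left)

lemma tr_power_p: "tr (x ^ CARD('p)) = tr x"
proof (rule injD[OF inj_incl])
  have "incl (tr (x ^ CARD('p))) = (\<Sum>i<n. x ^ (CARD('p) ^ Suc i))"
    by (simp add: incl_tr flip: power_mult)
  also have "\<dots> = (\<Sum>i<n. x ^ (CARD('p) ^ i)) + x ^ (CARD('p) ^ n) - x ^ (CARD('p) ^ 0)"
    using sum.lessThan_Suc_shift[of "\<lambda>i. x ^ (CARD('p) ^ i)" n] by (simp add: algebra_simps)
  finally show "incl (tr (x ^ CARD('p))) = incl (tr x)" by (simp add: power_card_ext incl_tr)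
qed

lemma tr_frobenius: "tr (x ^ (CARD('p) ^ i)) = tr x"
proof (induction i)
  case (Suc i)
  have "x ^ (CARD('p) ^ Suc i) = (x ^ (CARD('p) ^ i)) ^ CARD('p)" by (simp add: mult.commute flip: power_mult)
  then show ?case using Suc tr_power_p by simp
qed simp

text \<open>As a polynomial the trace is nonzero of degree at most \<open>p ^ (n - 1)\<close>, less
  than the number of field elements, so it has a non-root, whose trace can be scaled to
  \<open>1\<close>.\<close>

lemma tr_surj_1: "\<exists>x. tr x = 1"
proof -
  define f :: "'a poly" where "f = (\<Sum>i<n. monom 1 (CARD('p) ^ i))"
  have p1: "CARD('p) > 1" using prime_p prime_gt_1_nat by blast
  have "coeff f 1 = (\<Sum>i<n. if i = 0 then 1 else 0)"
    unfolding f_def coeff_sum using p1 by (intro sum.cong) auto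
  also have "\<dots> = 1" using n_pos by simp
  finally have f0: "f \<noteq> 0" by auto
  have "degree f \<le> CARD('p) ^ (n - 1)"
    unfolding f_def
    by (intro degree_sum_le order.trans[OF degree_monom_le] power_increasing) (use p1 in auto)
  also have "\<dots> < CARD('p) ^ n" using p1 n_pos by (intro power_strict_increasing) auto
  finally have "card {x. poly f x = 0} < CARD('a)"
    using card_poly_roots_bound[OF f0] card_ext by simp
  then obtain x where "poly f x \<noteq> 0"
    by (metis (mono_tags, lifting) UNIV_eq_I less_irrefl mem_Collect_eq)
  then have "incl (tr x) \<noteq> 0" by (simp add: f_def poly_sum poly_monom incl_tr)
  then have "tr x \<noteq> 0" by auto
  then have "tr (incl (inverse (tr x)) * x) = 1" by (simp add: tr_scale)
  then show ?thesis by blast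
qed

lemma sum_eps_tr:
  "(\<Sum>y\<in>UNIV. eps_pow (tr (y * z))) = (if z = 0 then of_nat (CARD('p) ^ n) else 0)"
proof -
  have "(\<Sum>y\<in>UNIV. eps_pow (tr (y * z))) = (if \<forall>y\<in>UNIV. eps_pow (tr (y * z)) = 1 then of_nat CARD('a) else 0)"
    by (rule sum_character_subgroup) (simp_all add: distrib_right tr_add eps_pow_add)
  moreover have "\<not> (\<forall>y\<in>UNIV. eps_pow (tr (y * z)) = 1)" if "z \<noteq> 0"
  proof -
    obtain x where "tr x = 1" using tr_surj_1 by blast
    then have "eps_pow (tr (x / z * z)) \<noteq> 1" using that eps_pow_1_neq_1[OF odd_p] by simp
    then show ?thesis by blast
  qed
  ultimately show ?thesis by (auto simp: card_ext)
qed

end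

section \<open>Linearized polynomials and the Walsh transform\<close>

text \<open>Nonempty fibres are translates of the kernel. The inequality suffices: it bounds an
  image from below in \<open>card_kernel_lin_dvd\<close>, where counting roots gives the opposite
  bound.\<close>

lemma card_le_card_kernel_range:
  fixes f :: "'a::{ab_group_add,finite} \<Rightarrow> 'b::ab_group_add"
  assumes add: "\<And>x y. f (x - y) = f x - f y"
  shows "CARD('a) \<le> card {x. f x = 0} * card (range f)"
proof -
  have fibre: "card {x. f x = y} \<le> card {x. f x = 0}" if y: "y \<in> range f" for y
  proof -
    obtain x0 where x0: "y = f x0" using y by blast
    have "(\<lambda>x. x - x0) ` {x. f x = y} \<subseteq> {x. f x = 0}" by (auto simp: add x0)
    moreover have "card ((\<lambda>x. x - x0) ` {x. f x = y}) = card {x. f x = y}"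
      by (rule card_image) (auto intro: inj_onI)
    ultimately show ?thesis by (metis card_mono finite)
  qed
  have "CARD('a) = card (\<Union>y\<in>range f. {x. f x = y})"
    by (rule arg_cong[of _ _ card]) auto
  also have "\<dots> \<le> (\<Sum>y\<in>range f. card {x. f x = y})"
    by (rule card_UN_le) simp
  also have "\<dots> \<le> (\<Sum>y\<in>range f. card {x. f x = 0})"
    by (rule sum_mono) (rule fibre)
  finally show ?thesis by (simp add: mult.commute)
qed

context prime_field_extension
begin

text \<open>The action of polynomials over the prime field on the extension, with \<open>x\<close> acting as the Frobenius map.\<close>

definition lin :: "'p mod_ring poly \<Rightarrow> 'a \<Rightarrow> 'a" where
  "lin G x = (\<Sum>i\<le>degree G. incl (coeff G i) * x ^ (CARD('p) ^ i))"

lemma lin_altdef: "degree G \<le> m \<Longrightarrow> lin G x = (\<Sum>i\<le>m. incl (coeff G i) * x ^ (CARD('p) ^ i))"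
  unfolding lin_def by (rule sum.mono_neutral_left) (auto simp: coeff_eq_0)

lemma lin_add: "lin (G + H) x = lin G x + lin H x"
proof -
  define m where "m = max (degree G) (degree H)"
  have "degree G \<le> m" "degree H \<le> m" "degree (G + H) \<le> m"
    by (simp_all add: m_def degree_add_le_max)
  then show ?thesis
    by (simp add: lin_altdef incl_add distrib_right sum.distrib)
qed

lemma lin_0 [simp]: "lin 0 x = 0"
  by (simp add: lin_def)

lemma lin_smult: "lin (smult c G) x = incl c * lin G x"
  by (simp add: lin_altdef[of _ "degree G"] incl_mult sum_distrib_left mult.assoc)

lemma lin_minus: "lin (- G) x = - lin G x"
  using lin_smult[of "- 1" G x] by (simp add: incl_minus)

lemma lin_sum: "lin (\<Sum>j\<in>J. f j) x = (\<Sum>j\<in>J. lin (f j) x)"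
  by (induction J rule: infinite_finite_induct) (simp_all add: lin_add)

lemma lin_monom: "lin (monom c i) x = incl c * x ^ (CARD('p) ^ i)"
proof -
  have "lin (monom c i) x = (\<Sum>j\<le>i. if j = i then incl c * x ^ (CARD('p) ^ i) else 0)"
    unfolding lin_altdef[OF degree_monom_le] by (rule sum.cong) auto
  then show ?thesis by simp
qed

text \<open>Coefficients from the prime field are fixed by the Frobenius map, so it can be pulled
  out of the sum.\<close>

lemma lin_pCons_0: "lin (pCons 0 G) x = lin G x ^ CARD('p)"
proof -
  have "lin (pCons 0 G) x = (\<Sum>i\<le>Suc (degree G). incl (coeff (pCons 0 G) i) * x ^ (CARD('p) ^ i))"
    by (rule lin_altdef) (rule degree_pCons_le)
  also have "\<dots> = (\<Sum>i\<le>degree G. incl (coeff G i) * x ^ (CARD('p) ^ Suc i))"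
    by (subst sum.atMost_Suc_shift) simp
  also have "\<dots> = (\<Sum>i\<le>degree G. (incl (coeff G i) * x ^ (CARD('p) ^ i)) ^ (CARD('p) ^ 1))"
    by (rule sum.cong[OF refl])
      (simp only: power_mult_distrib incl_power_p, simp add: mult.commute flip: power_mult)
  also have "\<dots> = lin G x ^ (CARD('p) ^ 1)"
    unfolding lin_def by (rule frobenius_sum[symmetric])
  finally show ?thesis by simp
qed

lemma lin_pCons: "lin (pCons a G) x = incl a * x + lin G x ^ CARD('p)"
proof -
  have "pCons a G = smult a 1 + pCons 0 G" by simp
  moreover have "lin 1 x = x" using lin_monom[of 1 0 x] by simp
  ultimately show ?thesis by (simp only: lin_add lin_smult lin_pCons_0)
qed

lemma lin_mult: "lin (G * H) x = lin G (lin H x)"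
proof (induction G)
  case (pCons a G)
  then show ?case
    by (simp add: mult_pCons_left lin_add lin_smult lin_pCons_0 lin_pCons)
qed simp

lemma lin_add_arg: "lin G (x + y) = lin G x + lin G y"
  by (simp add: lin_def frobenius_add distrib_left sum.distrib)

lemma lin_diff_arg: "lin G (x - y) = lin G x - lin G y"
  using lin_add_arg[of G "x - y" y] by simp

lemma lin_0_arg [simp]: "lin G 0 = 0"
  using lin_diff_arg[of G 0 0] by simp

lemma lin_monom_minus_1: "lin (monom 1 n - 1) x = 0"
proof -
  have "monom 1 n - 1 = monom 1 n + (- monom 1 0 :: 'p mod_ring poly)" by simp
  then show ?thesis by (simp only: lin_add lin_minus lin_monom power_card_ext) simp
qed

lemma card_kernel_lin_le:
  assumes "G \<noteq> 0"
  shows "card {x. lin G x = 0} \<le> CARD('p) ^ degree G"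
proof -
  define f :: "'a poly" where "f = (\<Sum>i\<le>degree G. monom (incl (coeff G i)) (CARD('p) ^ i))"
  have p1: "CARD('p) > 1" using prime_p prime_gt_1_nat by blast
  have "coeff f (CARD('p) ^ degree G) = (\<Sum>i\<le>degree G. if i = degree G then incl (lead_coeff G) else 0)"
    unfolding f_def coeff_sum using p1 by (intro sum.cong) (auto simp: power_inject_exp)
  also have "\<dots> = incl (lead_coeff G)" by simp
  finally have f0: "f \<noteq> 0" using assms by (auto simp: incl_eq_0_iff)
  have "degree f \<le> CARD('p) ^ degree G"
    unfolding f_def
    by (intro degree_sum_le order.trans[OF degree_monom_le] power_increasing) (use p1 in auto)
  moreover have "{x. poly f x = 0} = {x. lin G x = 0}"
    by (simp add: f_def lin_def poly_sum poly_monom)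
  ultimately show ?thesis using card_poly_roots_bound[OF f0] by simp
qed

text \<open>With \<open>G * H = x ^ n - 1\<close>, the image of \<open>lin H\<close> lies in the
  kernel of \<open>lin G\<close>. As the kernel of \<open>lin H\<close> has at most
  \<open>p ^ degree H\<close> elements, that image has at least \<open>p ^ degree G\<close>, which
  meets the root bound for \<open>G\<close>.\<close>

lemma card_kernel_lin_dvd:
  assumes "G dvd monom 1 n - 1"
  shows "card {x. lin G x = 0} = CARD('p) ^ degree G"
proof -
  obtain H where H: "monom 1 n - 1 = G * H" using assms by (elim dvdE)
  have p1: "CARD('p) > 1" using prime_p prime_gt_1_nat by blast
  have deg: "degree (monom 1 n - 1 :: 'p mod_ring poly) = n"
    by (rule degree_monom_minus_1[OF n_pos])
  then have nz: "G \<noteq> 0" "H \<noteq> 0" using H n_pos by auto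
  then have n: "n = degree G + degree H" using H deg by (simp add: degree_mult_eq)
  have "range (lin H) \<subseteq> {x. lin G x = 0}"
    by (auto simp: H[symmetric] lin_monom_minus_1 simp flip: lin_mult)
  then have "card (range (lin H)) \<le> card {x. lin G x = 0}" by (intro card_mono) auto
  then have "CARD('p) ^ n \<le> CARD('p) ^ degree H * card {x. lin G x = 0}"
    using card_le_card_kernel_range[of "lin H", OF lin_diff_arg] card_kernel_lin_le[OF nz(2)]
    unfolding card_ext by (meson mult_le_mono order.trans)
  then have "CARD('p) ^ degree G \<le> card {x. lin G x = 0}"
    unfolding n power_add using p1 by (simp add: mult.commute)
  then show ?thesis using card_kernel_lin_le[OF nz(1)] by simp
qed

text \<open>Since \<open>x ^ n - 1\<close> acts as zero, a Bezout combination shows that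
  \<open>G\<close> and its gcd with \<open>x ^ n - 1\<close> have the same kernel.\<close>

lemma card_kernel_lin: "card {x. lin G x = 0} = CARD('p) ^ degree (gcd G (monom 1 n - 1))"
proof -
  define N :: "'p mod_ring poly" where "N = monom 1 n - 1"
  obtain c where c: "G = gcd G N * c" by (meson gcd_dvd1 dvdE)
  have "lin G x = 0 \<longleftrightarrow> lin (gcd G N) x = 0" for x
  proof
    assume "lin G x = 0"
    moreover have "gcd G N = fst (bezout_coefficients G N) * G + snd (bezout_coefficients G N) * N"
      by (rule bezout_coefficients_fst_snd[symmetric])
    ultimately show "lin (gcd G N) x = 0"
      by (simp only: lin_add lin_mult N_def lin_monom_minus_1) simp
  next
    assume "lin (gcd G N) x = 0"
    moreover have "lin G x = lin (c * gcd G N) x" using c by (simp add: mult.commute)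
    ultimately show "lin G x = 0" by (simp add: lin_mult)
  qed
  then show ?thesis
    using card_kernel_lin_dvd[of "gcd G N"] by (simp add: N_def)
qed

section \<open>The quadratic form and its Walsh transform\<close>

definition sym_poly :: "(nat \<Rightarrow> 'p mod_ring) \<Rightarrow> 'p mod_ring poly" where
  "sym_poly a = (\<Sum>i=0..n div 2. monom (a i) i + monom (a i) (n - i))"

lemma lin_sym_poly:
  "lin (sym_poly a) x = (\<Sum>i=0..n div 2. incl (a i) * (x ^ (CARD('p) ^ i) + x ^ (CARD('p) ^ (n - i))))"
  by (simp add: sym_poly_def lin_sum lin_add lin_monom distrib_left)

abbreviation quad :: "(nat \<Rightarrow> 'p mod_ring) \<Rightarrow> 'a \<Rightarrow> 'p mod_ring" where
  "quad \<equiv> quad_fun n"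

lemma quad_altdef: "quad a x = (\<Sum>i=0..n div 2. a i * tr (x ^ (CARD('p) ^ i) * x))"
  unfolding quad_fun_def tr_sum tr_scale by (simp add: mult.commute)

text \<open>The trace is Frobenius invariant: \<open>n - i\<close> further steps turn \<open>y ^ (p ^ i) * x\<close> into \<open>y * x ^ (p ^ (n - i))\<close>.\<close>

lemma quad_add: "quad a (x + y) = quad a x + quad a y + tr (y * lin (sym_poly a) x)"
proof -
  have swap: "tr (y ^ (CARD('p) ^ i) * x) = tr (y * x ^ (CARD('p) ^ (n - i)))" if "i \<le> n" for i
  proof -
    have "(y ^ (CARD('p) ^ i) * x) ^ (CARD('p) ^ (n - i)) = y ^ (CARD('p) ^ n) * x ^ (CARD('p) ^ (n - i))"
      using that by (simp add: power_mult_distrib flip: power_mult power_add)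
    then show ?thesis
      by (metis tr_frobenius power_card_ext)
  qed
  have "tr ((x + y) ^ (CARD('p) ^ i) * (x + y)) = tr (x ^ (CARD('p) ^ i) * x) + tr (y ^ (CARD('p) ^ i) * y)
      + tr (y * (x ^ (CARD('p) ^ i) + x ^ (CARD('p) ^ (n - i))))" if "i \<le> n" for i
    using swap[OF that] by (simp add: frobenius_add distrib_left distrib_right tr_add mult.commute)
  then have "quad a (x + y) = (\<Sum>i=0..n div 2. a i * (tr (x ^ (CARD('p) ^ i) * x) + tr (y ^ (CARD('p) ^ i) * y)
      + tr (y * (x ^ (CARD('p) ^ i) + x ^ (CARD('p) ^ (n - i))))))"
    unfolding quad_altdef by (intro sum.cong refl arg_cong2[where f = "(*)"]) simp
  also have "\<dots> = quad a x + quad a y + (\<Sum>i=0..n div 2. tr (incl (a i) * (y * (x ^ (CARD('p) ^ i) + x ^ (CARD('p) ^ (n - i))))))"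
    unfolding quad_altdef tr_scale by (simp add: distrib_left sum.distrib)
  also have "(\<Sum>i=0..n div 2. tr (incl (a i) * (y * (x ^ (CARD('p) ^ i) + x ^ (CARD('p) ^ (n - i)))))) = tr (y * lin (sym_poly a) x)"
    unfolding lin_sym_poly sum_distrib_left tr_sum by (simp add: mult.left_commute)
  finally show ?thesis .
qed

lemma quad_0 [simp]: "quad a 0 = 0"
  by (simp add: quad_altdef)

lemma quad_minus: "quad a (- x) = quad a x"
proof -
  have "(- x) ^ (CARD('p) ^ i) = - (x ^ (CARD('p) ^ i))" for i
    by (rule power_minus_odd) (use odd_p in simp)
  then show ?thesis by (simp add: quad_altdef)
qed

text \<open>The form is even because \<open>p\<close> is odd, so polarization at \<open>x\<close>
  and \<open>- x\<close> gives \<open>2 * quad a x = 0\<close>.\<close>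

lemma quad_kernel:
  assumes "lin (sym_poly a) x = 0"
  shows "quad a x = 0"
proof -
  have "quad a x + quad a (- x) = 0"
    using quad_add[of a x "- x"] assms by simp
  then have "2 * quad a x = 0" by (simp only: quad_minus mult_2)
  then show ?thesis using two_neq_0_mod_ring[OF odd_p] by simp
qed

text \<open>After the substitution \<open>x = z + y\<close> the variable \<open>y\<close> occurs
  only in one trace term; summing over \<open>y\<close> gives \<open>p ^ n\<close> for
  \<open>z\<close> in the kernel and \<open>0\<close> elsewhere.\<close>

lemma walsh_times_cnj:
  "walsh n (quad a) b * cnj (walsh n (quad a) b) =
     of_nat (CARD('p) ^ n) * (\<Sum>z | lin (sym_poly a) z = 0. eps_pow (quad a z - tr (b * z)))"
proof -
  define e where "e = (\<lambda>z. eps_pow (quad a z - tr (b * z)))"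
  have "walsh n (quad a) b * cnj (walsh n (quad a) b) = (\<Sum>x\<in>UNIV. \<Sum>y\<in>UNIV. e x * cnj (e y))"
    by (simp add: walsh_def e_def sum_product)
  also have "\<dots> = (\<Sum>y\<in>UNIV. \<Sum>x\<in>UNIV. e x * cnj (e y))"
    by (rule sum.swap)
  also have "\<dots> = (\<Sum>y\<in>UNIV. \<Sum>z\<in>UNIV. e (z + y) * cnj (e y))"
  proof (rule sum.cong[OF refl])
    fix y
    show "(\<Sum>x\<in>UNIV. e x * cnj (e y)) = (\<Sum>z\<in>UNIV. e (z + y) * cnj (e y))"
      by (rule sum.reindex_bij_witness[of _ "\<lambda>z. z + y" "\<lambda>x. x - y"]) auto
  qed
  also have "\<dots> = (\<Sum>y\<in>UNIV. \<Sum>z\<in>UNIV. e z * eps_pow (tr (y * lin (sym_poly a) z)))"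
  proof (intro sum.cong refl)
    fix y z
    have "quad a (z + y) - tr (b * (z + y)) + - (quad a y - tr (b * y)) =
        (quad a z - tr (b * z)) + tr (y * lin (sym_poly a) z)"
      by (simp add: quad_add distrib_left tr_add)
    then show "e (z + y) * cnj (e y) = e z * eps_pow (tr (y * lin (sym_poly a) z))"
      unfolding e_def cnj_eps_pow eps_pow_add[symmetric] by simp
  qed
  also have "\<dots> = (\<Sum>z\<in>UNIV. e z * (\<Sum>y\<in>UNIV. eps_pow (tr (y * lin (sym_poly a) z))))"
    by (subst sum.swap) (simp add: sum_distrib_left)
  also have "\<dots> = (\<Sum>z\<in>UNIV. if lin (sym_poly a) z = 0 then of_nat (CARD('p) ^ n) * e z else 0)"
    by (rule sum.cong) (simp_all add: sum_eps_tr)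
  also have "\<dots> = of_nat (CARD('p) ^ n) * (\<Sum>z | lin (sym_poly a) z = 0. e z)"
    by (simp add: sum.If_cases sum_distrib_left)
  finally show ?thesis by (simp add: e_def)
qed

text \<open>On the kernel, which has \<open>p ^ s\<close> elements, the summand is a character, so
  every squared absolute value is \<open>0\<close> or \<open>p ^ (n + s)\<close>. The nonzero value
  does occur, which determines \<open>s\<close>.\<close>

lemma plateaued_quad_iff:
  assumes "s' \<le> n"
  shows "plateaued n s' (quad a) \<longleftrightarrow> degree (gcd (sym_poly a) (monom 1 n - 1)) = s'"
proof -
  define s where "s = degree (gcd (sym_poly a) (monom 1 n - 1))"
  define K where "K = {z. lin (sym_poly a) z = 0}"
  define W where "W = walsh n (quad a)"
  have p1: "CARD('p) > 1" using prime_p prime_gt_1_nat by blast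
  have cardK: "card K = CARD('p) ^ s" by (simp add: K_def s_def card_kernel_lin)
  have sq: "cmod (W b) = real CARD('p) powr ((real n + real s) / 2)" if "cmod (W b) ^ 2 = real CARD('p) ^ (n + s)" for b
  proof -
    have "(real CARD('p) powr ((real n + real s) / 2)) ^ 2 = real CARD('p) ^ (n + s)"
      using p1 by (simp add: powr_powr add_divide_distrib flip: powr_realpow)
    then have "cmod (W b) ^ 2 = (real CARD('p) powr ((real n + real s) / 2)) ^ 2" using that by simp
    then show ?thesis by (rule power2_eq_imp_eq) simp_all
  qed
  have norm_sq: "complex_of_real (cmod (W b) ^ 2) = of_nat (CARD('p) ^ n) * (\<Sum>z\<in>K. eps_pow (quad a z - tr (b * z)))" for b
    unfolding K_def W_def walsh_times_cnj[symmetric] by (rule complex_norm_square)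
  have val: "cmod (W b) \<in> {0, real CARD('p) powr ((real n + real s) / 2)}" for b
  proof -
    have "(\<Sum>z\<in>K. eps_pow (quad a z - tr (b * z))) =
        (if \<forall>z\<in>K. eps_pow (quad a z - tr (b * z)) = 1 then of_nat (card K) else 0)"
    proof (rule sum_character_subgroup)
      fix x y assume xy: "x \<in> K" "y \<in> K"
      then show "x + y \<in> K" "x - y \<in> K" by (simp_all add: K_def lin_add_arg lin_diff_arg)
      show "eps_pow (quad a (x + y) - tr (b * (x + y))) = eps_pow (quad a x - tr (b * x)) * eps_pow (quad a y - tr (b * y))"
        using xy by (simp add: K_def quad_add distrib_left tr_add algebra_simps flip: eps_pow_add)
    qed simp
    then have "complex_of_real (cmod (W b) ^ 2) = 0 \<or> complex_of_real (cmod (W b) ^ 2) = complex_of_real (real CARD('p) ^ (n + s))"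
      unfolding norm_sq cardK by (auto simp: power_add)
    then have "cmod (W b) ^ 2 = 0 \<or> cmod (W b) ^ 2 = real CARD('p) ^ (n + s)"
      by (simp only: of_real_eq_iff of_real_eq_0_iff)
    then show ?thesis
    proof
      assume "cmod (W b) ^ 2 = 0"
      then show ?thesis by simp
    next
      assume "cmod (W b) ^ 2 = real CARD('p) ^ (n + s)"
      then show ?thesis using sq by blast
    qed
  qed
  \<comment> \<open>At \<open>b = 0\<close> the character is trivial, because the form vanishes on
    the kernel.\<close>
  have "complex_of_real (cmod (W 0) ^ 2) = complex_of_real (real CARD('p) ^ (n + s))"
  proof -
    have "(\<Sum>z\<in>K. eps_pow (quad a z - tr (0 * z))) = (\<Sum>z\<in>K. 1)"
      by (rule sum.cong) (simp_all add: K_def quad_kernel)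
    then show ?thesis unfolding norm_sq by (simp add: cardK power_add)
  qed
  then have W0: "cmod (W 0) = real CARD('p) powr ((real n + real s) / 2)"
    by (intro sq) (simp only: of_real_eq_iff)
  show ?thesis
    unfolding s_def[symmetric]
  proof
    assume "plateaued n s' (quad a)"
    then have "cmod (W 0) \<in> {0, real CARD('p) powr ((real n + real s') / 2)}"
      unfolding plateaued_def W_def by blast
    moreover have "cmod (W 0) \<noteq> 0" unfolding W0 using p1 by simp
    ultimately have "real CARD('p) powr ((real n + real s) / 2) = real CARD('p) powr ((real n + real s') / 2)"
      unfolding W0 by blast
    moreover have "1 < real CARD('p)" using p1 by linarith
    ultimately have "(real n + real s) / 2 = (real n + real s') / 2"
      by (subst (asm) powr_inj) auto
    then show "s = s'" by simp
  next
    assume s: "s = s'"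
    show "plateaued n s' (quad a)"
      unfolding plateaued_def using val assms unfolding s W_def by blast
  qed
qed

end

section \<open>Counting plateaued functions\<close>

text \<open>Reversal about \<open>n\<close> changes \<open>A\<close> by a polynomial of degree at
  most \<open>n\<close>, which is divisible by \<open>x ^ n - 1\<close> only as a scalar multiple.
  Such a multiple affects positions \<open>0\<close> and \<open>n\<close> alone, so all other
  positions must match their mirror images.\<close>

lemma mem_sym_residues_monom_minus_1_iff:
  fixes A :: "'k::field_gcd poly"
  assumes n: "n > 0"
  shows "A \<in> sym_residues n (monom 1 n - 1) \<longleftrightarrow>
    (\<forall>j\<ge>n. coeff A j = 0) \<and> (\<forall>j. 0 < j \<and> j < n \<longrightarrow> coeff A j = coeff A (n - j))"
proof (cases "\<forall>j\<ge>n. coeff A j = 0")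
  case False
  then show ?thesis
    using mod_eq_self_iff_coeff[OF monom_minus_1_nonzero[OF n], of A]
    by (simp only: sym_residues_def degree_monom_minus_1[OF n] mem_Collect_eq simp_thms)
next
  case True
  define N :: "'k poly" where "N = monom 1 n - 1"
  define D where "D = rev_window n A - A"
  have degA: "degree A \<le> n" by (rule degree_le) (use True in simp)
  have degD: "degree D \<le> n"
    unfolding D_def by (intro degree_diff_le degree_rev_window degA)
  have cN: "coeff N j = (if j = n then 1 else 0) - (if j = 0 then 1 else 0)" for j
    by (auto simp: N_def)
  have cD: "coeff D j = (if j \<le> n then coeff A (n - j) else 0) - coeff A j" for j
    by (simp add: D_def coeff_rev_window)
  have "A mod N = A"
    using True mod_eq_self_iff_coeff[OF monom_minus_1_nonzero[OF n], of A]
    by (simp add: N_def degree_monom_minus_1[OF n])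
  moreover have "[recip n A = rev_window n A] (mod N)"
  proof -
    have "[1 * recip n A = monom 1 n * recip n A] (mod N)"
      unfolding N_def by (intro cong_mult cong_refl cong_sym[OF monom_n_cong_1])
    also have "[monom 1 n * recip n A = rev_window n A] (mod N)"
      unfolding N_def by (rule monom_mult_recip_cong[OF n degA])
    finally show ?thesis by simp
  qed
  then have "[recip n A = A] (mod N) \<longleftrightarrow> N dvd D"
    unfolding D_def cong_iff_dvd_diff[symmetric] by (metis cong_sym cong_trans)
  moreover have "N dvd D \<longleftrightarrow> (\<forall>j. 0 < j \<and> j < n \<longrightarrow> coeff A j = coeff A (n - j))"
  proof
    assume "N dvd D"
    then obtain Q where Q: "D = N * Q" by (elim dvdE)
    have "degree Q = 0"
    proof (cases "Q = 0")
      case False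
      then have "degree D = n + degree Q"
        using monom_minus_1_nonzero[OF n, where 'k = 'k] degree_monom_minus_1[OF n, where 'k = 'k]
        unfolding Q by (subst degree_mult_eq) (simp_all add: N_def)
      then show ?thesis using degD by simp
    qed simp
    then obtain t where "Q = [:t:]" by (metis degree_eq_zeroE)
    then have D: "D = smult t N" using Q by simp
    show "\<forall>j. 0 < j \<and> j < n \<longrightarrow> coeff A j = coeff A (n - j)"
    proof (intro allI impI)
      fix j assume j: "0 < j \<and> j < n"
      then have "coeff D j = 0" by (simp add: D cN)
      then show "coeff A j = coeff A (n - j)" using j by (simp add: cD)
    qed
  next
    assume *: "\<forall>j. 0 < j \<and> j < n \<longrightarrow> coeff A j = coeff A (n - j)"
    \<comment> \<open>The scalar is forced at position \<open>n\<close>: there reversal puts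
      \<open>coeff A 0\<close>, while \<open>A\<close> itself has coefficient
      \<open>0\<close>.\<close>
    have "D = smult (coeff A 0) N"
    proof (rule poly_eqI)
      fix j
      consider "j = 0" | "j = n" "j \<noteq> 0" | "j > n" | "0 < j" "j < n" by linarith
      then show "coeff D j = coeff (smult (coeff A 0) N) j"
      proof cases
        case 4
        then have "coeff A j = coeff A (n - j)" using * by blast
        then show ?thesis using 4 by (simp add: cD cN)
      qed (use True n in \<open>auto simp: cD cN\<close>)
    qed
    then show "N dvd D" by (simp add: dvd_smult)
  qed
  ultimately show ?thesis
    using True unfolding sym_residues_def N_def[symmetric] mem_Collect_eq by blast
qed

context prime_field_extension
begin

text \<open>The term for index \<open>0\<close> is \<open>a 0 * (1 + x ^ n)\<close>; subtracting
  \<open>a 0 * (x ^ n - 1)\<close> replaces it by the constant \<open>2 * a 0\<close> and yields the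
  remainder modulo \<open>x ^ n - 1\<close>.\<close>

definition sym_reduced :: "(nat \<Rightarrow> 'p mod_ring) \<Rightarrow> 'p mod_ring poly" where
  "sym_reduced a = sym_poly a - smult (a 0) (monom 1 n - 1)"

lemma coeff_sym_reduced:
  "coeff (sym_reduced a) j =
    (if j = 0 then 2 * a 0 else if 2 * j = n then 2 * a j else if 2 * j < n then a j
     else if j < n then a (n - j) else 0)"
proof -
  define h where "h = n div 2"
  have hn: "h < n" "2 * h \<le> n" "n \<le> 2 * h + 1" using n_pos unfolding h_def by presburger+
  have "coeff (sym_poly a) j = (\<Sum>i=0..h. (if i = j then a i else 0) + (if n - i = j then a i else 0))"
    by (simp add: sym_poly_def coeff_sum h_def)
  also have "\<dots> = (\<Sum>i=0..h. if i = j then a j else 0) + (\<Sum>i=0..h. if i = n - j \<and> j \<le> n then a (n - j) else 0)"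
    unfolding sum.distrib
    by (intro arg_cong2[where f = "(+)"] sum.cong refl) (use hn in auto)
  also have "\<dots> = (if j \<le> h then a j else 0) + (if n - j \<le> h \<and> j \<le> n then a (n - j) else 0)"
    by (cases "j \<le> n") simp_all
  finally have c: "coeff (sym_poly a) j = (if j \<le> h then a j else 0) + (if n - j \<le> h \<and> j \<le> n then a (n - j) else 0)" .
  consider "j = 0" | "j > 0" "2 * j = n" | "j > 0" "2 * j < n" | "2 * j > n" "j < n" | "j = n" | "j > n" by linarith
  then show ?thesis
  proof cases
    case 2
    then have "j \<le> h" "n - j = j" "j < n" using hn by linarith+
    then show ?thesis using 2 by (simp add: sym_reduced_def c)
  next
    case 3
    then have "j \<le> h" "\<not> n - j \<le> h" using hn by linarith+
    then show ?thesis using 3 by (simp add: sym_reduced_def c)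
  next
    case 4
    then have "\<not> j \<le> h" "n - j \<le> h" using hn by linarith+
    then show ?thesis using 4 by (simp add: sym_reduced_def c)
  qed (use c hn n_pos in \<open>simp_all add: sym_reduced_def\<close>)
qed

lemma sym_reduced_residue: "sym_reduced a \<in> sym_residues n (monom 1 n - 1)"
  unfolding mem_sym_residues_monom_minus_1_iff[OF n_pos]
proof (intro conjI allI impI)
  fix j assume "j \<ge> n"
  then show "coeff (sym_reduced a) j = 0" using n_pos by (auto simp: coeff_sym_reduced)
next
  fix j assume j: "0 < j \<and> j < n"
  consider "2 * j = n" | "2 * j < n" | "2 * j > n" by linarith
  then show "coeff (sym_reduced a) j = coeff (sym_reduced a) (n - j)"
    using j by cases (auto simp: coeff_sym_reduced)
qed

text \<open>The indices \<open>0..n div 2\<close> represent the orbits of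
  \<open>j \<mapsto> - j\<close> modulo \<open>n\<close>. The one-element orbits \<open>0\<close>
  and \<open>n div 2\<close> receive their coefficient twice, so recovering it requires division by
  \<open>2\<close>.\<close>

lemma bij_betw_sym_reduced:
  assumes even: "even n"
  shows "bij_betw sym_reduced ({0..n div 2} \<rightarrow>\<^sub>E UNIV) (sym_residues n (monom 1 n - 1))"
proof (intro bij_betwI')
  fix a b assume ab: "a \<in> {0..n div 2} \<rightarrow>\<^sub>E (UNIV :: 'p mod_ring set)" "b \<in> {0..n div 2} \<rightarrow>\<^sub>E (UNIV :: 'p mod_ring set)"
  show "(sym_reduced a = sym_reduced b) = (a = b)"
  proof
    assume eq: "sym_reduced a = sym_reduced b"
    show "a = b"
    proof (rule PiE_ext[OF ab])
      fix j assume "j \<in> {0..n div 2}"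
      then consider "j = 0" | "j \<noteq> 0" "2 * j = n" | "j \<noteq> 0" "2 * j < n" by auto linarith
      moreover have "coeff (sym_reduced a) j = coeff (sym_reduced b) j" by (simp only: eq)
      ultimately show "a j = b j"
        unfolding coeff_sym_reduced using two_neq_0_mod_ring[OF odd_p] by cases simp_all
    qed
  qed simp
next
  fix A assume A: "A \<in> sym_residues n (monom 1 n - 1 :: 'p mod_ring poly)"
  define a where "a = restrict (\<lambda>j. if j = 0 \<or> 2 * j = n then coeff A j / 2 else coeff A j) {0..n div 2}"
  have "A = sym_reduced a"
  proof (rule poly_eqI)
    fix j
    consider "j = 0" | "j > 0" "2 * j = n" | "j > 0" "2 * j < n" | "2 * j > n" "j < n" | "j \<ge> n" by linarith
    then show "coeff A j = coeff (sym_reduced a) j"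
    proof cases
      case 4
      then have j_pos: "0 < j" by simp
      with 4 have "coeff A j = coeff A (n - j)"
        using A unfolding mem_sym_residues_monom_minus_1_iff[OF n_pos] by blast
      moreover have "n - j \<le> n div 2" "2 * (n - j) \<noteq> n" "n - j \<noteq> 0" using 4 by linarith+
      ultimately show ?thesis using 4 by (simp add: coeff_sym_reduced a_def)
    next
      case 5
      then have "coeff A j = 0"
        using A unfolding mem_sym_residues_monom_minus_1_iff[OF n_pos] by blast
      then show ?thesis using 5 n_pos by (simp add: coeff_sym_reduced)
    qed (use two_neq_0_mod_ring[OF odd_p] in \<open>auto simp: coeff_sym_reduced a_def\<close>)
  qed
  moreover have "a \<in> {0..n div 2} \<rightarrow>\<^sub>E UNIV" by (simp add: a_def)
  ultimately show "\<exists>a\<in>{0..n div 2} \<rightarrow>\<^sub>E UNIV. A = sym_reduced a" by blast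
qed (rule sym_reduced_residue)

lemma gcd_sym_reduced: "gcd (sym_reduced a) (monom 1 n - 1) = gcd (sym_poly a) (monom 1 n - 1)"
proof -
  define N :: "'p mod_ring poly" where "N = monom 1 n - 1"
  have "[sym_reduced a = sym_poly a] (mod N)"
    by (simp add: cong_iff_dvd_diff sym_reduced_def N_def dvd_smult)
  then show ?thesis unfolding N_def by (rule cong_gcd_eq)
qed

lemma plateaued_count_eq:
  assumes "even n" and "s \<le> n"
  shows "plateaued_count A P n s =
    card {B \<in> sym_residues n (monom 1 n - 1 :: 'p mod_ring poly). degree (gcd B (monom 1 n - 1)) = s}"
proof -
  have "bij_betw sym_reduced
      {a \<in> {0..n div 2} \<rightarrow>\<^sub>E UNIV. degree (gcd (sym_reduced a) (monom 1 n - 1)) = s}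
      {B \<in> sym_residues n (monom 1 n - 1). degree (gcd B (monom 1 n - 1)) = s}"
    by (rule bij_betw_Collect[OF bij_betw_sym_reduced[OF assms(1)]]) simp
  then have "card {a \<in> {0..n div 2} \<rightarrow>\<^sub>E UNIV. degree (gcd (sym_reduced a) (monom 1 n - 1)) = s} =
      card {B \<in> sym_residues n (monom 1 n - 1 :: 'p mod_ring poly). degree (gcd B (monom 1 n - 1)) = s}"
    by (rule bij_betw_same_card)
  then show ?thesis
    unfolding plateaued_count_def plateaued_quad_iff[OF assms(2)] gcd_sym_reduced .
qed

lemma plateaued_gf_eq_sym_gf:
  assumes "even n"
  shows "(\<Sum>t=0..n. monom (int (plateaued_count A P n (n - t))) t) = sym_gf n (monom 1 n - 1 :: 'p mod_ring poly)"
proof -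
  define N :: "'p mod_ring poly" where "N = monom 1 n - 1"
  define S where "S = sym_residues n N"
  have N: "N \<noteq> 0" "degree N = n"
    using monom_minus_1_nonzero[OF n_pos] degree_monom_minus_1[OF n_pos] by (simp_all add: N_def)
  have le: "degree (gcd B N) \<le> n" for B
    using dvd_imp_degree_le[OF gcd_dvd2 N(1)] N(2) by simp
  have "sym_gf n N = (\<Sum>t=0..n. \<Sum>B\<in>{B \<in> S. n - degree (gcd B N) = t}. monom 1 (n - degree (gcd B N)))"
    unfolding sym_gf_def N(2) S_def
    by (rule sum.group[symmetric]) (use finite_sym_residues[OF N(1)] in auto)
  also have "\<dots> = (\<Sum>t=0..n. monom (int (plateaued_count A P n (n - t))) t)"
  proof (rule sum.cong[OF refl])
    fix t assume t: "t \<in> {0..n}"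
    \<comment> \<open>No subtraction is truncated, as the gcd degree and \<open>t\<close> are both
      at most \<open>n\<close>.\<close>
    have "{B \<in> S. n - degree (gcd B N) = t} = {B \<in> S. degree (gcd B N) = n - t}"
      using le t by (auto simp: le_antisym)
    moreover have "(\<Sum>B\<in>{B \<in> S. n - degree (gcd B N) = t}. monom (1 :: int) (n - degree (gcd B N))) =
        (\<Sum>B\<in>{B \<in> S. n - degree (gcd B N) = t}. monom 1 t)"
      by (rule sum.cong) simp_all
    ultimately show "(\<Sum>B\<in>{B \<in> S. n - degree (gcd B N) = t}. monom (1 :: int) (n - degree (gcd B N))) =
        monom (int (plateaued_count A P n (n - t))) t"
      using plateaued_count_eq[OF assms, of "n - t"] by (simp add: S_def N_def of_nat_monom mult_monom)
  qed
  finally show ?thesis by (simp add: N_def)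
qed

end

theorem theorem4:
  fixes p n v k :: nat
    and r :: "nat \<Rightarrow> 'p::prime_card mod_ring poly"
  assumes "CARD('p) = p" and "odd p"
    and "n > 0" and "even n"
    and "CARD('a::{field,finite}) = p ^ n"
    and "v = multiplicity p n"
    and "monom 1 n - 1 =
           [:-1, 1:] ^ (p ^ v) * [:1, 1:] ^ (p ^ v) * (\<Prod>i=1..k. r i ^ (p ^ v))"
    and "inj_on r {1..k}"
    and "\<And>i. i \<in> {1..k} \<Longrightarrow> prime_self_reciprocal (r i)"
    and "\<And>i. i \<in> {1..k} \<Longrightarrow> even (degree (r i))"
  shows "(\<Sum>t=0..n. monom (int (plateaued_count TYPE('a) TYPE('p) n (n - t))) t) =
           (1 + (\<Sum>j=1..(p ^ v + 1) div 2. monom (int p ^ (j - 1) * (int p - 1)) (2 * j - 1))) ^ 2 *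
           (\<Prod>i=1..k. 1 +
              (\<Sum>j=1..p ^ v.
                 monom (int p ^ (degree (r i ^ j) div 2)
                          - int p ^ ((degree (r i ^ j) - degree (r i)) div 2))
                       (j * degree (r i))))"
proof -
  interpret prime_field_extension n "TYPE('a)" "TYPE('p)"
    by unfold_locales (use assms(1-5) in simp_all)
  show ?thesis
    unfolding plateaued_gf_eq_sym_gf[OF assms(4)]
    by (rule sym_gf_monom_minus_1[OF assms(1-4,6,7,9,10)])
qed

end
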